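(* Let $m,n$ be positive integers and let $\psi:\mathbb{R}_+\to\mathbb{R}_+$ be a non-increasing continuous function. If $$\sum_{x=1}^\infty\psi(x)$$ diverges, then almost every lattice $\Lambda$ in $\Upsilon_{m+n}=\mathrm{SL}_{m+n}(k)/\mathrm{SL}_{m+n}(Z)$ is $(\psi,n)$-approximable.
   Context: Let $\mathbb{F}_s$ be the finite field with $s$ elements ($s$ a prime power), $Z=\mathbb{F}_s[X]$, $k=\mathbb{F}_s((X^{-1}))$ with absolute value $|a|=s^{-v(a)}$, where for $a=\sum_i a_iX^{-i}$, $v(a)=\sup\{j\in\mathbb{Z}: a_i=0\ \forall i<j\}$. $\|\cdot\|$ is the sup norm. $\Upsilon_{m+n}=\mathrm{SL}_{m+n}(k)/\mathrm{SL}_{m+n}(Z)$ is identified with the space of unimodular (covolume $1$) lattices (discrete free $Z$-modules of maximal rank) in $k^{m+n}$ via $g\mapsto gZ^{m+n}$; "almost every" is with respect to the $\mathrm{SL}_{m+n}(k)$-invariant probability measure. For $\mathbf{v}\in k^{m+n}$, $\mathbf{v}^{(m)}$ denotes the vector of its first $m$ coordinates and $\mathbf{v}_{(n)}$ the vector of its last $n$ coordinates. A lattice $\Lambda\in\Upsilon_{m+n}$ is $(\psi,n)$-approximable if there exist infinitely many $\mathbf{v}\in\Lambda$ with arbitrarily large $\|\mathbf{v}_{(n)}\|$ such that $$\|\mathbf{v}^{(m)}\|^m\le\psi(\|\mathbf{v}_{(n)}\|^n).$$ *)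

theory Defs
  imports "HOL-Probability.Probability" "HOL-Computational_Algebra.Formal_Laurent_Series"
begin

text \<open>
  The field of Laurent series in the inverse of X over a finite field is the library type
  \<open>'a fls\<close> with \<open>fls_X\<close> in the role of the inverse of X, so X itself is \<open>fls_X_inv\<close>, the
  coefficient of the i-th power of the inverse of X is \<open>fls_nth a i\<close>, and the valuation of a
  nonzero element is \<open>fls_subdegree\<close>.  The coordinates of the (m+n)-dimensional space are indexed
  by \<open>'m + 'n\<close>; \<open>Inl\<close> selects the first m of them and \<open>Inr\<close> the last n.
\<close>

text \<open>The case split is needed because \<open>fls_subdegree 0 = 0\<close>, whereas the valuation of 0 is infinite.\<close>

definition abs_fls :: "'a::{field,finite} fls \<Rightarrow> real" where
  "abs_fls a = (if a = 0 then 0 else real CARD('a) powi (- fls_subdegree a))"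

definition vnorm :: "('a::{field,finite} fls) ^ 'd \<Rightarrow> real" where
  "vnorm v = Max (range (\<lambda>i. abs_fls (vec_nth v i)))"

definition upper_part :: "'a ^ ('m::finite + 'n::finite) \<Rightarrow> 'a ^ 'm" where
  "upper_part v = (\<chi> i. vec_nth v (Inl i))"

definition lower_part :: "'a ^ ('m::finite + 'n::finite) \<Rightarrow> 'a ^ 'n" where
  "lower_part v = (\<chi> j. vec_nth v (Inr j))"

definition poly_ring :: "'a::{field,finite} fls set" where
  "poly_ring = range (\<lambda>p :: 'a poly. poly (map_poly fls_const p) fls_X_inv)"

definition poly_vecs :: "(('a::{field,finite} fls) ^ 'd) set" where
  "poly_vecs = {v. \<forall>i. vec_nth v i \<in> poly_ring}"

definition SL :: "(('a::{field,finite} fls) ^ 'd ^ 'd) set" where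
  "SL = {g. det g = 1}"

definition SL_poly :: "(('a::{field,finite} fls) ^ 'd ^ 'd) set" where
  "SL_poly = {g \<in> SL. \<forall>i j. vec_nth (vec_nth g i) j \<in> poly_ring}"

definition lattice_of :: "('a::{field,finite} fls) ^ 'd ^ 'd \<Rightarrow> (('a fls) ^ 'd) set" where
  "lattice_of g = (\<lambda>v. g *v v) ` poly_vecs"

text \<open>
  The quotient of \<open>SL\<close> by \<open>SL_poly\<close>, realised as the space of unimodular lattices: a coset is
  represented by the lattice \<open>lattice_of g\<close> of any of its members (see
  \<open>lattice_of_eq_iff\<close> below).
\<close>

definition lattice_space :: "(('a::{field,finite} fls) ^ 'd) set set" where
  "lattice_space = lattice_of ` SL"

text \<open>The Borel sigma-algebra of the quotient topology.\<close>

definition lattice_borel :: "(('a::{field,finite} fls) ^ 'd) set measure" where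
  "lattice_borel = sigma lattice_space
     {U. U \<subseteq> lattice_space \<and> openin (top_of_set SL) {g \<in> SL. lattice_of g \<in> U}}"

text \<open>
  The image of a lattice L under h is the set of all \<open>h *v v\<close> with v in L, so that
  h maps \<open>lattice_of g\<close> to \<open>lattice_of (h ** g)\<close>.  A measure with this property exists and
  is unique, because \<open>SL_poly\<close> is a lattice in \<open>SL\<close>.
\<close>

definition invariant_probability :: "(('a::{field,finite} fls) ^ 'd) set measure \<Rightarrow> bool" where
  "invariant_probability \<mu> \<longleftrightarrow>
     prob_space \<mu> \<and> sets \<mu> = sets lattice_borel \<and>
     (\<forall>h \<in> SL. \<forall>A \<in> sets \<mu>. emeasure \<mu> ((\<lambda>L. (\<lambda>v. h *v v) ` L) ` A) = emeasure \<mu> A)"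

definition approximable ::
  "(real \<Rightarrow> real) \<Rightarrow> (('a::{field,finite} fls) ^ ('m::finite + 'n::finite)) set \<Rightarrow> bool" where
  "approximable \<psi> L \<longleftrightarrow>
     (\<forall>R. infinite {v \<in> L. vnorm (lower_part v) > R \<and>
        vnorm (upper_part v) ^ CARD('m) \<le> \<psi> (vnorm (lower_part v) ^ CARD('n))})"

text \<open>
  The following facts confirm that the encoding above is the intended one: the absolute value
  induces the library topology of \<open>'a fls\<close>, polynomials are the series without terms of positive
  index, and two matrices span the same lattice iff they lie in the same coset.
\<close>

lemma open_fls_iff_abs:
  fixes S :: "'a::{field,finite} fls set"
  shows "open S \<longleftrightarrow> (\<forall>a\<in>S. \<exists>e>0. \<forall>b. abs_fls (b - a) < e \<longrightarrow> b \<in> S)"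
proof -
  have dist: "dist b a = (if b = a then 0 else 2 powi (- fls_subdegree (b - a)))" for a b :: "'a fls"
    by (auto simp: dist_fls_def power_int_def power_one_over inverse_eq_divide)
  have dist_lt: "(\<exists>e>0. \<forall>b. dist b a < e \<longrightarrow> b \<in> S) \<longleftrightarrow>
      (\<exists>N. \<forall>b. b = a \<or> fls_subdegree (b - a) > N \<longrightarrow> b \<in> S)" for a
  proof
    assume "\<exists>e>0. \<forall>b. dist b a < e \<longrightarrow> b \<in> S"
    then obtain e where e: "e > 0" "\<And>b. dist b a < e \<Longrightarrow> b \<in> S" by blast
    obtain n where n: "(1/2::real) ^ n < e" using real_arch_pow_inv[of e "1/2"] e by auto
    have "b \<in> S" if "b = a \<or> fls_subdegree (b - a) > int n" for b
    proof (cases "b = a")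
      case False
      then have "dist b a \<le> 2 powi (- int n)"
        using that by (auto simp: dist intro!: power_int_increasing)
      also have "\<dots> = (1/2) ^ n" by (simp add: power_int_minus power_one_over field_simps)
      finally show ?thesis using e n by force
    qed (use e in auto)
    then show "\<exists>N. \<forall>b. b = a \<or> fls_subdegree (b - a) > N \<longrightarrow> b \<in> S" by blast
  next
    assume "\<exists>N. \<forall>b. b = a \<or> fls_subdegree (b - a) > N \<longrightarrow> b \<in> S"
    then obtain N where N: "\<And>b. b = a \<or> fls_subdegree (b - a) > N \<Longrightarrow> b \<in> S" by blast
    have "b \<in> S" if "dist b a < 2 powi (- N)" for b
    proof (rule N, rule disjCI)
      assume "\<not> N < fls_subdegree (b - a)"
      then have "(2::real) powi (- N) \<le> 2 powi (- fls_subdegree (b - a))"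
        by (intro power_int_increasing) auto
      then show "b = a" using that by (auto simp: dist split: if_splits)
    qed
    then show "\<exists>e>0. \<forall>b. dist b a < e \<longrightarrow> b \<in> S"
      by (intro exI[of _ "2 powi (- N)"]) auto
  qed
  have "card {0, 1::'a} \<le> CARD('a)" by (intro card_mono) auto
  then have s: "real CARD('a) \<ge> 2" by simp
  have abs_lt: "(\<exists>e>0. \<forall>b. abs_fls (b - a) < e \<longrightarrow> b \<in> S) \<longleftrightarrow>
      (\<exists>N. \<forall>b. b = a \<or> fls_subdegree (b - a) > N \<longrightarrow> b \<in> S)" for a
  proof
    assume "\<exists>e>0. \<forall>b. abs_fls (b - a) < e \<longrightarrow> b \<in> S"
    then obtain e where e: "e > 0" "\<And>b. abs_fls (b - a) < e \<Longrightarrow> b \<in> S" by blast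
    obtain n where n: "(1 / real CARD('a)) ^ n < e"
      using real_arch_pow_inv[of e "1 / real CARD('a)"] e s by auto
    have "b \<in> S" if "b = a \<or> fls_subdegree (b - a) > int n" for b
    proof (cases "b = a")
      case False
      then have "abs_fls (b - a) \<le> real CARD('a) powi (- int n)"
        using that s by (auto simp: abs_fls_def intro!: power_int_increasing)
      also have "\<dots> = (1 / real CARD('a)) ^ n"
        by (simp add: power_int_minus power_one_over field_simps)
      finally show ?thesis using e n by force
    qed (use e in \<open>auto simp: abs_fls_def\<close>)
    then show "\<exists>N. \<forall>b. b = a \<or> fls_subdegree (b - a) > N \<longrightarrow> b \<in> S" by blast
  next
    assume "\<exists>N. \<forall>b. b = a \<or> fls_subdegree (b - a) > N \<longrightarrow> b \<in> S"
    then obtain N where N: "\<And>b. b = a \<or> fls_subdegree (b - a) > N \<Longrightarrow> b \<in> S" by blast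
    have "b \<in> S" if "abs_fls (b - a) < real CARD('a) powi (- N)" for b
    proof (rule N, rule disjCI)
      assume "\<not> N < fls_subdegree (b - a)"
      then have "real CARD('a) powi (- N) \<le> real CARD('a) powi (- fls_subdegree (b - a))"
        using s by (intro power_int_increasing) auto
      then show "b = a" using that by (auto simp: abs_fls_def split: if_splits)
    qed
    moreover have "real CARD('a) powi (- N) > 0" using s by (intro zero_less_power_int) auto
    ultimately show "\<exists>e>0. \<forall>b. abs_fls (b - a) < e \<longrightarrow> b \<in> S" by blast
  qed
  show ?thesis by (simp add: open_dist dist_lt abs_lt)
qed

lemma poly_fls_nth:
  fixes p :: "'a::{field,finite} poly"
  shows "fls_nth (poly (map_poly fls_const p) fls_X_inv) i = (if i \<le> 0 then coeff p (nat (- i)) else 0)"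
proof (induction p arbitrary: i)
  case (pCons c p)
  have m: "map_poly fls_const (pCons c p) = pCons (fls_const c) (map_poly fls_const p)"
    by (simp add: map_poly_pCons)
  have "nat (- i) = Suc (nat (- (i + 1)))" if "i < 0" using that by linarith
  then show ?case
    using pCons.IH[of "i + 1"]
    by (cases "i < 0") (auto simp: m fls_X_inv_times_conv_shift)
qed simp

lemma poly_ring_iff: "a \<in> poly_ring \<longleftrightarrow> (\<forall>i>0. fls_nth a i = 0)"
proof
  assume a: "\<forall>i>0. fls_nth a i = 0"
  have "n \<le> nat (- fls_subdegree a)" if "fls_nth a (- int n) \<noteq> 0" for n
    using fls_subdegree_leI[OF that] by linarith
  then have "{n::nat. fls_nth a (- int n) \<noteq> 0} \<subseteq> {..nat (- fls_subdegree a)}" by blast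
  then have "finite {n::nat. fls_nth a (- int n) \<noteq> 0}" by (rule finite_subset) (rule finite_atMost)
  then have "coeff (Abs_poly (\<lambda>n. fls_nth a (- int n))) = (\<lambda>n. fls_nth a (- int n))"
    by (intro Abs_poly_inverse) (simp add: MOST_iff_cofinite)
  with a have "a = poly (map_poly fls_const (Abs_poly (\<lambda>n. fls_nth a (- int n)))) fls_X_inv"
    by (intro fls_eqI) (simp add: poly_fls_nth)
  then show "a \<in> poly_ring" unfolding poly_ring_def by (rule range_eqI)
next
  assume "a \<in> poly_ring"
  then show "\<forall>i>0. fls_nth a i = 0" by (auto simp: poly_ring_def poly_fls_nth)
qed

lemma poly_ring_mult:
  assumes a: "a \<in> poly_ring" and b: "b \<in> poly_ring"
  shows "a * b \<in> poly_ring"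
proof -
  have "fls_nth (a * b) n = 0" if "n > 0" for n
    unfolding fls_times_nth(2)
  proof (intro sum.neutral ballI)
    fix i
    have "i > 0 \<or> n - i > 0" using that by linarith
    then show "fls_nth a i * fls_nth b (n - i) = 0"
      using a b by (auto simp: poly_ring_iff)
  qed
  then show ?thesis by (simp add: poly_ring_iff)
qed

lemma poly_ring_closed:
  fixes a b :: "'a::{field,finite} fls"
  shows "(0::'a fls) \<in> poly_ring" "(1::'a fls) \<in> poly_ring"
    "a \<in> poly_ring \<Longrightarrow> - a \<in> poly_ring"
    "a \<in> poly_ring \<Longrightarrow> b \<in> poly_ring \<Longrightarrow> a + b \<in> poly_ring"
    "a \<in> poly_ring \<Longrightarrow> b \<in> poly_ring \<Longrightarrow> a * b \<in> poly_ring"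
proof -
  show "(0::'a fls) \<in> poly_ring" unfolding poly_ring_iff by simp
  show "(1::'a fls) \<in> poly_ring" unfolding poly_ring_iff by simp
  show "- a \<in> poly_ring" if "a \<in> poly_ring"
    using that unfolding poly_ring_iff by simp
  show "a + b \<in> poly_ring" if "a \<in> poly_ring" "b \<in> poly_ring"
    using that unfolding poly_ring_iff by simp
  show "a * b \<in> poly_ring" if "a \<in> poly_ring" "b \<in> poly_ring"
    using that by (rule poly_ring_mult)
qed

lemma poly_ring_sum: "(\<And>x. x \<in> A \<Longrightarrow> f x \<in> poly_ring) \<Longrightarrow> sum f A \<in> poly_ring"
  by (induction A rule: infinite_finite_induct) (auto intro: poly_ring_closed)

lemma poly_ring_prod: "(\<And>x. x \<in> A \<Longrightarrow> f x \<in> poly_ring) \<Longrightarrow> prod f A \<in> poly_ring"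
  by (induction A rule: infinite_finite_induct) (auto intro: poly_ring_closed)

lemma matrix_vector_poly_vecs:
  assumes "\<forall>i j. vec_nth (vec_nth g i) j \<in> poly_ring" "v \<in> poly_vecs"
  shows "g *v v \<in> poly_vecs"
  using assms by (auto simp: poly_vecs_def matrix_vector_mult_def intro!: poly_ring_sum poly_ring_closed)

lemma det_poly_ring:
  assumes "\<forall>i j. vec_nth (vec_nth g i) j \<in> poly_ring"
  shows "det g \<in> poly_ring"
proof -
  have "of_int (sign p) * (\<Prod>i\<in>UNIV. vec_nth (vec_nth g i) (p i)) \<in> poly_ring" for p
    using assms by (auto simp: sign_def intro!: poly_ring_closed poly_ring_prod)
  then show ?thesis unfolding det_def by (auto intro: poly_ring_sum)
qed

lemma SL_poly_image:
  assumes "g \<in> SL_poly"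
  shows "lattice_of g = poly_vecs"
proof
  show "lattice_of g \<subseteq> poly_vecs"
    using assms by (auto simp: lattice_of_def SL_poly_def intro: matrix_vector_poly_vecs)
  show "poly_vecs \<subseteq> lattice_of g"
  proof
    fix b :: "'a fls ^ 'b" assume b: "b \<in> poly_vecs"
    define x where "x = (\<chi> k. det (\<chi> i j. if j = k then vec_nth b i else vec_nth (vec_nth g i) j) / det g)"
    have "det g = 1" using assms by (simp add: SL_poly_def SL_def)
    then have "g *v x = b" using cramer[of g x b] by (simp add: x_def)
    moreover have "x \<in> poly_vecs"
      using assms b \<open>det g = 1\<close>
      by (auto simp: poly_vecs_def x_def SL_poly_def intro!: det_poly_ring)
    ultimately show "b \<in> lattice_of g" by (auto simp: lattice_of_def)
  qed
qed

lemma lattice_of_mult: "lattice_of (h ** g) = (\<lambda>v. h *v v) ` lattice_of g"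
  by (simp add: lattice_of_def image_image matrix_vector_mul_assoc)

lemma lattice_of_eq_iff:
  assumes "g \<in> SL" "h \<in> SL"
  shows "lattice_of g = lattice_of h \<longleftrightarrow> (\<exists>\<gamma>\<in>SL_poly. g = h ** \<gamma>)"
proof
  assume "\<exists>\<gamma>\<in>SL_poly. g = h ** \<gamma>"
  then show "lattice_of g = lattice_of h"
    using SL_poly_image by (auto simp: lattice_of_mult) (auto simp: lattice_of_def)
next
  assume eq: "lattice_of g = lattice_of h"
  from assms have "invertible h" by (simp add: invertible_det_nz SL_def)
  then obtain h' where h': "h ** h' = mat 1" "h' ** h = mat 1" by (auto simp: invertible_def)
  have g: "g = h ** (h' ** g)" by (simp add: matrix_mul_assoc h')
  have "det h * det (h' ** g) = det g" using g by (metis det_mul)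
  then have det: "det (h' ** g) = 1" using assms by (simp add: SL_def)
  have "vec_nth (vec_nth (h' ** g) i) j \<in> poly_ring" for i j
  proof -
    have "axis j 1 \<in> poly_vecs" by (simp add: poly_vecs_def axis_def poly_ring_closed)
    then have "g *v axis j 1 \<in> lattice_of h" using eq by (auto simp: lattice_of_def)
    then obtain w where w: "w \<in> poly_vecs" "g *v axis j 1 = h *v w" by (auto simp: lattice_of_def)
    then have "(h' ** g) *v axis j 1 = w"
      by (metis h'(2) matrix_vector_mul_assoc matrix_vector_mul_lid)
    moreover have "vec_nth ((h' ** g) *v axis j 1) i = vec_nth (vec_nth (h' ** g) i) j"
      by (simp add: matrix_vector_mult_def axis_def if_distrib cong: if_cong)
    ultimately have "vec_nth (vec_nth (h' ** g) i) j = vec_nth w i" by simp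
    then show ?thesis using w by (simp add: poly_vecs_def)
  qed
  with det have "h' ** g \<in> SL_poly" by (simp add: SL_poly_def SL_def)
  with g show "\<exists>\<gamma>\<in>SL_poly. g = h ** \<gamma>" by blast
qed

end

theory Submission
  imports Defs
begin

text \<open>
  Apply the diagonal flow that multiplies the first m coordinates by \<open>X^(nt)\<close> and the last n by
  \<open>X^(-mt)\<close>.  By invariance of the measure, at every time t all lattices outside a set of small
  measure have at least one and at most M vectors in a fixed window.  Average over the finite
  group of shears that add to the i-th upper coordinate \<open>a $ i\<close> times a fixed lower coordinate:
  for a vector in the window the ratios of the upper coordinates to that lower coordinate are
  translated by the \<open>a $ i\<close>, so the proportion of shears that make the ratios small is known
  exactly.  Hence, whatever coarser information on earlier times is prescribed, the approximation
  event E at time t has conditional probability at least p(t), and p is not summable because the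
  series of the \<open>\<psi>(x)\<close> diverges.

  An earlier event E(i) is not determined by the coarse information available at time t, but it is
  contained in a set that is, namely its union with a set Y(i,t) whose measure decays
  geometrically in t - i.  If the times are spaced widely, the sets Y(i,t) are negligible.  The
  events E(t), restricted to the complement of all earlier E(i) and Y(i,t), are disjoint, so
  these complements cannot have measure bounded away from 0, that is, almost every lattice lies in
  some E(i).
\<close>

no_notation fps_nth (infixl "$" 75)

section \<open>Digits of Laurent series\<close>

text \<open>The closed ball of radius \<open>s^(-N)\<close> about 0, where s is the order of the
  finite field. Reading it off the coefficients puts 0 into every ball, although
  \<open>fls_subdegree 0 = 0\<close>.\<close>

definition vanishes_below :: "int \<Rightarrow> 'a::zero fls \<Rightarrow> bool" where
  "vanishes_below N x \<longleftrightarrow> (\<forall>i<N. fls_nth x i = 0)"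

text \<open>For \<open>a \<le> N\<close>, representatives of the ball
  \<open>vanishes_below a\<close> modulo the subgroup \<open>vanishes_below N\<close>.\<close>

definition digits :: "int \<Rightarrow> int \<Rightarrow> 'a::zero fls set" where
  "digits a N = {x. \<forall>i. i < a \<or> N \<le> i \<longrightarrow> fls_nth x i = 0}"

lemma vanishes_below_iff: "vanishes_below N x \<longleftrightarrow> x = 0 \<or> N \<le> fls_subdegree x"
  by (auto simp: vanishes_below_def intro: fls_subdegree_geI)

lemma vanishes_below_0 [simp]: "vanishes_below N 0"
  by (simp add: vanishes_below_def)

lemma vanishes_below_mono: "vanishes_below N x \<Longrightarrow> M \<le> N \<Longrightarrow> vanishes_below M x"
  by (auto simp: vanishes_below_def)

lemma vanishes_below_add:
  "vanishes_below N x \<Longrightarrow> vanishes_below N y \<Longrightarrow> vanishes_below N (x + y)"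
  for x y :: "'a::monoid_add fls"
  by (auto simp: vanishes_below_def)

lemma vanishes_below_add_cancel:
  "vanishes_below N y \<Longrightarrow> vanishes_below N (x + y) \<longleftrightarrow> vanishes_below N x"
  for x y :: "'a::monoid_add fls"
  by (auto simp: vanishes_below_def)

lemma vanishes_below_mult:
  "vanishes_below N x \<Longrightarrow> vanishes_below M y \<Longrightarrow> vanishes_below (N + M) (x * y)"
  for x y :: "'a::field fls"
  by (cases "x = 0"; cases "y = 0") (auto simp: vanishes_below_iff)

lemma vanishes_below_sum:
  "(\<And>i. i \<in> I \<Longrightarrow> vanishes_below N (f i)) \<Longrightarrow> vanishes_below N (sum f I)"
  for f :: "'b \<Rightarrow> 'a::comm_monoid_add fls"
  by (induction I rule: infinite_finite_induct) (auto intro: vanishes_below_add)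

lemma vanishes_below_divide_iff:
  "y \<noteq> 0 \<Longrightarrow> vanishes_below N (x / y) \<longleftrightarrow> vanishes_below (N + fls_subdegree y) x"
  for x y :: "'a::field fls"
  by (cases "x = 0") (auto simp: vanishes_below_iff fls_divide_subdegree)

lemma vanishes_below_shift_mult:
  "vanishes_below N (fls_shift j 1 * x) \<longleftrightarrow> vanishes_below (N + j) x"
  for x :: "'a::field fls"
  using fls_subdegree_mult_fls_X_intpow(1)[of x "- j"] fls_X_intpow_nonzero[of "- j", where 'a = 'a]
  by (cases "x = 0") (auto simp: vanishes_below_iff)

lemma one_less_CARD: "1 < real CARD('a::{field,finite})"
proof -
  have "card {0, 1::'a} \<le> CARD('a)" by (intro card_mono) auto
  then show ?thesis by simp
qed

section \<open>Norm inequalities as vanishing of coefficients\<close>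

lemma abs_fls_le_iff: "abs_fls x \<le> real CARD('a) powi (- N) \<longleftrightarrow> vanishes_below N x"
  for x :: "'a::{field,finite} fls"
  using one_less_CARD[where 'a='a]
    power_int_strict_increasing[of "- N" "- fls_subdegree x" "real CARD('a)"]
  by (auto simp: abs_fls_def vanishes_below_iff not_le[symmetric] intro: power_int_increasing)

lemma vnorm_le_iff: "vnorm v \<le> real CARD('a) powi (- N) \<longleftrightarrow> (\<forall>i. vanishes_below N (v $ i))"
  for v :: "('a::{field,finite} fls) ^ 'd"
  by (auto simp: vnorm_def abs_fls_le_iff[symmetric])

lemma abs_fls_le_vnorm: "abs_fls (v $ i) \<le> vnorm v"
  by (auto simp: vnorm_def)

lemma vnorm_nonneg: "0 \<le> vnorm v"
  by (rule order_trans[OF _ abs_fls_le_vnorm]) (simp add: abs_fls_def)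

section \<open>Counting representatives of a ball modulo a smaller ball\<close>

lemma digits_vanishes: "x \<in> digits a N \<Longrightarrow> vanishes_below a x"
  by (auto simp: digits_def vanishes_below_def)

text \<open>The coefficients with index in \<open>{a..<N}\<close> are free, all others are 0. For
  \<open>N < a\<close> only 0 remains, in agreement with \<open>nat (N - a) = 0\<close>.\<close>

lemma card_digits:
  fixes a N :: int
  shows "card (digits a N :: 'a::{field,finite} fls set) = CARD('a) ^ nat (N - a)"
    and "finite (digits a N :: 'a fls set)"
proof -
  define F where "F x = restrict (fls_nth x) {a..<N}" for x :: "'a fls"
  have "bij_betw F (digits a N) (PiE {a..<N} (\<lambda>_. UNIV))"
  proof (rule bij_betw_imageI)
    show "inj_on F (digits a N)"
    proof (rule inj_onI, rule fls_eqI)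
      fix x y :: "'a fls" and i
      assume x: "x \<in> digits a N" "y \<in> digits a N" "F x = F y"
      show "fls_nth x i = fls_nth y i"
        using x(1,2) fun_cong[OF x(3), of i] by (cases "i \<in> {a..<N}") (auto simp: F_def digits_def)
    qed
    show "F ` digits a N = PiE {a..<N} (\<lambda>_. UNIV)"
    proof (intro equalityI subsetI)
      fix f :: "int \<Rightarrow> 'a" assume f: "f \<in> PiE {a..<N} (\<lambda>_. UNIV)"
      define x where "x = Abs_fls (\<lambda>i. if i \<in> {a..<N} then f i else 0)"
      have x: "fls_nth x i = (if i \<in> {a..<N} then f i else 0)" for i
        unfolding x_def by (subst nth_Abs_fls_lower_bound[of a]) auto
      have "x \<in> digits a N" by (auto simp: digits_def x)
      moreover have "F x = f"
        using f by (auto simp: F_def fun_eq_iff x restrict_def PiE_def extensional_def)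
      ultimately show "f \<in> F ` digits a N" by blast
    qed (auto simp: F_def)
  qed
  then show "card (digits a N :: 'a fls set) = CARD('a) ^ nat (N - a)" "finite (digits a N :: 'a fls set)"
    using finite_PiE[of "{a..<N}" "\<lambda>_. UNIV :: 'a set"]
    by (auto simp: card_PiE dest: bij_betw_same_card bij_betw_finite)
qed

text \<open>The condition fixes the digits of x from a to b - 1 as the negatives of those of c and
  leaves the later ones free. Adding the truncation t of c therefore identifies the solutions with
  \<open>digits b N\<close>.\<close>

lemma card_digits_vanishes:
  fixes c :: "'a::{field,finite} fls"
  assumes c: "vanishes_below a c" and le: "a \<le> b" "b \<le> N"
  shows "card {x \<in> digits a N. vanishes_below b (c + x)} = CARD('a) ^ nat (N - b)"
proof -
  define t where "t = Abs_fls (\<lambda>i. if i \<in> {a..<b} then fls_nth c i else 0)"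
  have t: "fls_nth t i = (if i \<in> {a..<b} then fls_nth c i else 0)" for i
    unfolding t_def by (subst nth_Abs_fls_lower_bound[of a]) auto
  have "{x \<in> digits a N. vanishes_below b (c + x)} = (\<lambda>y. y - t) ` digits b N"
  proof (intro equalityI subsetI)
    fix x assume x: "x \<in> {x \<in> digits a N. vanishes_below b (c + x)}"
    have "fls_nth (x + t) i = 0" if i: "i < b \<or> N \<le> i" for i
    proof (cases "i < b")
      case True
      then have "fls_nth c i + fls_nth x i = 0" using x by (auto simp: vanishes_below_def)
      moreover have "fls_nth x i = 0" if "i < a" using x that by (auto simp: digits_def)
      ultimately show ?thesis using True by (auto simp: t add.commute)
    next
      case False
      then show ?thesis using x i le by (auto simp: t digits_def)
    qed
    then have "x + t \<in> digits b N" by (auto simp: digits_def)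
    then show "x \<in> (\<lambda>y. y - t) ` digits b N" by (intro image_eqI[of _ _ "x + t"]) auto
  next
    fix x assume "x \<in> (\<lambda>y. y - t) ` digits b N"
    then obtain y where y: "x = y - t" "y \<in> digits b N" by blast
    then show "x \<in> {x \<in> digits a N. vanishes_below b (c + x)}"
      using c le by (auto simp: digits_def vanishes_below_def t)
  qed
  moreover have "inj_on (\<lambda>y. y - t) (digits b N)" by (auto intro: inj_onI)
  ultimately show ?thesis by (simp add: card_image card_digits)
qed

lemma card_vec_box:
  fixes S :: "'m::finite \<Rightarrow> 'b set"
  assumes "\<And>i. finite (S i)"
  shows "card {v. \<forall>i. v $ i \<in> S i} = (\<Prod>i\<in>UNIV. card (S i))" "finite {v. \<forall>i. v $ i \<in> S i}"
proof -
  have "bij_betw (\<lambda>v. vec_nth v) {v. \<forall>i. v $ i \<in> S i} (PiE UNIV S)"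
    by (rule bij_betwI[where g = vec_lambda]) (auto simp: vec_eq_iff)
  then show "card {v. \<forall>i. v $ i \<in> S i} = (\<Prod>i\<in>UNIV. card (S i))" "finite {v. \<forall>i. v $ i \<in> S i}"
    using finite_PiE[of UNIV S] assms
    by (auto simp: card_PiE dest: bij_betw_same_card bij_betw_finite)
qed

definition digit_vecs :: "int \<Rightarrow> int \<Rightarrow> ('a::zero fls ^ 'm) set" where
  "digit_vecs a N = {v. \<forall>i. v $ i \<in> digits a N}"

lemma finite_digit_vecs: "finite (digit_vecs a N :: ('a::{field,finite} fls ^ 'm::finite) set)"
  unfolding digit_vecs_def by (intro card_vec_box card_digits)

lemma card_digit_vecs:
  "card (digit_vecs a N :: ('a::{field,finite} fls ^ 'm::finite) set) = CARD('a) ^ (CARD('m) * nat (N - a))"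
  unfolding digit_vecs_def
  by (subst card_vec_box) (simp_all add: card_digits power_mult[symmetric] mult.commute)

lemma digit_vecs_nonempty: "(0::'a::zero fls^'m) \<in> digit_vecs a N"
  by (auto simp: digit_vecs_def digits_def)

text \<open>The coordinates can be treated independently, so the proportion of good translations is
  \<open>s^(-m (b - a))\<close>, whatever z is.\<close>

lemma card_digit_vecs_vanishes:
  fixes z :: "'m::finite \<Rightarrow> 'a::{field,finite} fls"
  assumes z: "\<And>i. vanishes_below a (z i)" and le: "a \<le> b" "b \<le> N"
  shows "real (card {v \<in> digit_vecs a N. \<forall>i. vanishes_below b (z i + v $ i)}) =
    (1 / real CARD('a)) ^ (CARD('m) * nat (b - a)) *
    real (card (digit_vecs a N :: ('a fls ^ 'm) set))"
proof -
  have "{v \<in> digit_vecs a N. \<forall>i. vanishes_below b (z i + v $ i)} =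
      {v. \<forall>i. v $ i \<in> {x \<in> digits a N. vanishes_below b (z i + x)}}"
    by (auto simp: digit_vecs_def)
  then have "card {v \<in> digit_vecs a N. \<forall>i. vanishes_below b (z i + v $ i)} =
      CARD('a) ^ (CARD('m) * nat (N - b))"
    using card_vec_box[of "\<lambda>i. {x \<in> digits a N. vanishes_below b (z i + x)}"] card_digits(2)[of a N, where 'a='a]
    by (simp add: card_digits_vanishes[OF z le] power_mult[symmetric] mult.commute)
  moreover have "CARD('m) * nat (N - a) = CARD('m) * nat (N - b) + CARD('m) * nat (b - a)"
    using le by (simp add: distrib_left[symmetric] nat_add_distrib[symmetric])
  ultimately show ?thesis
    by (simp add: card_digit_vecs power_add power_one_over)
qed

section \<open>The action on the space of lattices\<close>

lemma SL_inverse: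
  assumes "h \<in> SL"
  obtains h' where "h' \<in> SL" "h' ** h = mat 1" "h ** h' = mat 1"
proof -
  from assms have "invertible h" by (simp add: invertible_det_nz SL_def)
  then obtain h' where h': "h ** h' = mat 1" "h' ** h = mat 1" by (auto simp: invertible_def)
  have "det h * det h' = 1" using h'(1) by (metis det_mul det_I)
  then have "h' \<in> SL" using assms by (simp add: SL_def)
  with h' that show thesis by blast
qed

lemma SL_cancel:
  assumes "h' ** h = mat 1"
  shows "h' *v (h *v v) = v"
  using assms by (simp add: matrix_vector_mul_assoc)

lemma SL_image_cancel:
  assumes "h' ** h = mat 1"
  shows "(*v) h' ` (*v) h ` L = L"
  by (simp add: image_image SL_cancel[OF assms])

lemma inj_SL: "h \<in> SL \<Longrightarrow> inj ((*v) h)"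
  by (metis SL_inverse SL_cancel injI)

lemma lattice_space_image:
  assumes "h \<in> SL" "L \<in> lattice_space"
  shows "(*v) h ` L \<in> lattice_space"
proof -
  obtain g where g: "g \<in> SL" "L = lattice_of g" using assms(2) by (auto simp: lattice_space_def)
  moreover have "h ** g \<in> SL" using assms(1) g(1) by (simp add: SL_def det_mul)
  ultimately show ?thesis by (auto simp: lattice_space_def lattice_of_mult[symmetric])
qed

section \<open>Measurability of conditions on the lattice points in an open set\<close>

lemma sets_lattice_borel:
  "sets lattice_borel = sigma_sets lattice_space
     {U. U \<subseteq> lattice_space \<and> openin (top_of_set SL) {g \<in> SL. lattice_of g \<in> U}}"
  unfolding lattice_borel_def by (rule sets_measure_of) auto

lemma space_lattice_borel: "space lattice_borel = lattice_space"
  unfolding lattice_borel_def by (rule space_measure_of) auto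

text \<open>By the ultrametric inequality every point of a ball is a centre of it.\<close>

lemma open_vanishes_below: "open {x. vanishes_below N (x - c)}"
  for c :: "'a::{field,finite} fls"
  unfolding open_fls_iff_abs
proof (intro ballI)
  fix x assume x: "x \<in> {x. vanishes_below N (x - c)}"
  have "vanishes_below N (y - c)" if "abs_fls (y - x) < real CARD('a) powi (- N)" for y
    using vanishes_below_add[of N "y - x" "x - c"] x that
    by (simp add: abs_fls_le_iff[symmetric])
  moreover have "real CARD('a) powi (- N) > 0" by simp
  ultimately show "\<exists>e>0. \<forall>y. abs_fls (y - x) < e \<longrightarrow> y \<in> {x. vanishes_below N (x - c)}"
    by blast
qed

text \<open>This is openness in the product topology, written with balls; one N serves all
  coordinates because there are finitely many.\<close>

definition locally_constant_set :: "('a::group_add fls ^ 'd) set \<Rightarrow> bool" where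
  "locally_constant_set U \<longleftrightarrow>
     (\<forall>v\<in>U. \<exists>N. \<forall>v'. (\<forall>i. vanishes_below N (v' $ i - v $ i)) \<longrightarrow> v' \<in> U)"

text \<open>The coordinates of w lie in a common ball of index K, so altering the entries of g only
  from index N - K on alters \<open>g *v w\<close> only from index N on.\<close>

lemma openin_SL_orbit:
  fixes U :: "('a::{field,finite} fls ^ 'd) set"
  assumes "locally_constant_set U"
  shows "openin (top_of_set SL) {g \<in> SL. g *v w \<in> U}"
proof -
  obtain K where K: "\<And>j. vanishes_below K (w $ j)"
  proof
    fix j
    have "Min (range (\<lambda>j. fls_subdegree (w $ j))) \<le> fls_subdegree (w $ j)" by auto
    then show "vanishes_below (Min (range (\<lambda>j. fls_subdegree (w $ j)))) (w $ j)"
      by (simp add: vanishes_below_iff)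
  qed
  have ex: "\<exists>N. \<forall>h. (\<forall>i j. vanishes_below N (h $ i $ j - g $ i $ j)) \<longrightarrow> h *v w \<in> U"
    if g: "g *v w \<in> U" for g
  proof -
    obtain N where N: "\<And>v'. (\<forall>i. vanishes_below N (v' $ i - (g *v w) $ i)) \<Longrightarrow> v' \<in> U"
      using assms g unfolding locally_constant_set_def by blast
    have "h *v w \<in> U" if "\<forall>i j. vanishes_below (N - K) (h $ i $ j - g $ i $ j)" for h
    proof (rule N, rule allI)
      fix i
      have "(h *v w) $ i - (g *v w) $ i = (\<Sum>j\<in>UNIV. (h $ i $ j - g $ i $ j) * w $ j)"
        by (simp add: matrix_vector_mult_def sum_subtractf left_diff_distrib)
      also have "vanishes_below N \<dots>"
      proof (rule vanishes_below_sum)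
        fix j
        show "vanishes_below N ((h $ i $ j - g $ i $ j) * w $ j)"
          using vanishes_below_mult[OF that[rule_format, of i j] K[of j]] by simp
      qed
      finally show "vanishes_below N ((h *v w) $ i - (g *v w) $ i)" .
    qed
    then show ?thesis by blast
  qed
  then obtain N where N: "\<And>g h. g *v w \<in> U \<Longrightarrow>
      (\<forall>i j. vanishes_below (N g) (h $ i $ j - g $ i $ j)) \<Longrightarrow> h *v w \<in> U"
    by metis
  define T where "T = (\<Union>g\<in>{g \<in> SL. g *v w \<in> U}. {h. \<forall>i. h $ i \<in>
     {r. \<forall>j. r $ j \<in> {x. vanishes_below (N g) (x - g $ i $ j)}}})"
  have "open T"
    unfolding T_def
    by (intro open_UN ballI open_vector_box allI open_vanishes_below)
  moreover have "{g \<in> SL. g *v w \<in> U} = SL \<inter> T"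
    using N by (auto simp: T_def)
  ultimately show ?thesis by (auto simp: openin_open)
qed

text \<open>The preimage in \<open>SL\<close> is a union, over the k-element sets of polynomial
  vectors, of finite intersections of open sets from \<open>openin_SL_orbit\<close>; injectivity of
  g preserves k. So the set is a generator of the sigma-algebra.\<close>

lemma sets_many_lattice_points:
  fixes U :: "('a::{field,finite} fls ^ 'd) set"
  assumes "locally_constant_set U"
  shows "{L \<in> lattice_space. \<exists>F\<subseteq>L \<inter> U. finite F \<and> card F = k} \<in> sets lattice_borel"
proof -
  let ?A = "{L \<in> lattice_space. \<exists>F\<subseteq>L \<inter> U. finite F \<and> card F = k}"
  let ?W = "{F. F \<subseteq> poly_vecs \<and> finite F \<and> card F = k}"
  \<comment> \<open>The factor \<open>SL\<close> takes care of k = 0, where F is empty and the inner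
    intersection is \<open>UNIV\<close>.\<close>
  have "{g \<in> SL. lattice_of g \<in> ?A} = (\<Union>F\<in>?W. (\<Inter>w\<in>F. {g \<in> SL. g *v w \<in> U}) \<inter> SL)"
  proof (intro equalityI subsetI)
    fix g assume "g \<in> {g \<in> SL. lattice_of g \<in> ?A}"
    then obtain F where g: "g \<in> SL" and F: "F \<subseteq> lattice_of g" "F \<subseteq> U" "finite F" "card F = k" by auto
    obtain F' where F': "F' \<subseteq> poly_vecs" "F = (*v) g ` F'"
      using F(1) by (metis lattice_of_def subset_imageE)
    have inj: "inj_on ((*v) g) F'" by (rule inj_on_subset[OF inj_SL[OF g] subset_UNIV])
    have "finite F'" using F(3) finite_image_iff[OF inj] F'(2) by simp
    moreover have "card F' = k" using F(4) card_image[OF inj] F'(2) by simp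
    ultimately show "g \<in> (\<Union>F\<in>?W. (\<Inter>w\<in>F. {g \<in> SL. g *v w \<in> U}) \<inter> SL)"
      using F' F g by blast
  next
    fix g assume "g \<in> (\<Union>F\<in>?W. (\<Inter>w\<in>F. {g \<in> SL. g *v w \<in> U}) \<inter> SL)"
    then obtain F where F: "F \<subseteq> poly_vecs" "finite F" "card F = k" "g \<in> SL" "\<And>w. w \<in> F \<Longrightarrow> g *v w \<in> U"
      by auto
    have "card ((*v) g ` F) = k"
      using F(3) card_image[OF inj_on_subset[OF inj_SL[OF F(4)], of F]] by simp
    moreover have "(*v) g ` F \<subseteq> lattice_of g \<inter> U" "finite ((*v) g ` F)"
      using F by (auto simp: lattice_of_def)
    ultimately have "\<exists>F\<subseteq>lattice_of g \<inter> U. finite F \<and> card F = k" by blast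
    then show "g \<in> {g \<in> SL. lattice_of g \<in> ?A}"
      using F by (auto simp: lattice_space_def)
  qed
  also have "openin (top_of_set SL) \<dots>"
  proof (intro openin_Union ballI, clarify)
    fix F :: "('a fls ^ 'd) set" assume "finite F"
    then show "openin (top_of_set SL) ((\<Inter>w\<in>F. {g \<in> SL. g *v w \<in> U}) \<inter> SL)"
    proof (induction F rule: finite_induct)
      case empty
      show ?case by (simp add: openin_subtopology_self)
    next
      case (insert w F)
      have "openin (top_of_set SL) ({g \<in> SL. g *v w \<in> U} \<inter> ((\<Inter>w\<in>F. {g \<in> SL. g *v w \<in> U}) \<inter> SL))"
        by (intro openin_Int insert.IH openin_SL_orbit assms)
      then show ?case by (simp add: Int_assoc)
    qed
  qed
  finally show ?thesis unfolding sets_lattice_borel by (intro sigma_sets.Basic) auto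
qed

lemma sets_meets_lattice:
  fixes U :: "('a::{field,finite} fls ^ 'd) set"
  assumes "locally_constant_set U"
  shows "{L \<in> lattice_space. L \<inter> U \<noteq> {}} \<in> sets lattice_borel"
proof -
  have "(L \<inter> U \<noteq> {}) \<longleftrightarrow> (\<exists>F\<subseteq>L \<inter> U. finite F \<and> card F = 1)" for L
  proof
    assume "L \<inter> U \<noteq> {}"
    then obtain v where "v \<in> L \<inter> U" by blast
    then show "\<exists>F\<subseteq>L \<inter> U. finite F \<and> card F = 1" by (intro exI[of _ "{v}"]) auto
  next
    assume "\<exists>F\<subseteq>L \<inter> U. finite F \<and> card F = 1"
    then show "L \<inter> U \<noteq> {}" by (metis card.empty subset_empty zero_neq_one)
  qed
  then show ?thesis using sets_many_lattice_points[OF assms, of 1] by simp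
qed

text \<open>The complement asks for \<open>Suc M\<close> lattice points in U; an infinite
  intersection contains that many too, so finiteness comes along.\<close>

lemma sets_few_lattice_points:
  fixes U :: "('a::{field,finite} fls ^ 'd) set"
  assumes "locally_constant_set U"
  shows "{L \<in> lattice_space. finite (L \<inter> U) \<and> card (L \<inter> U) \<le> M} \<in> sets lattice_borel"
proof -
  have few_iff: "(finite X \<and> card X \<le> M) \<longleftrightarrow> \<not> (\<exists>F\<subseteq>X. finite F \<and> card F = Suc M)"
    (is "?few \<longleftrightarrow> \<not> ?many") for X :: "('a fls ^ 'd) set"
  proof
    assume ?few
    then have "finite X" "card X \<le> M" by auto
    then have "card F \<noteq> Suc M" if "F \<subseteq> X" for F
      using card_mono[OF \<open>finite X\<close> that] by linarith
    then show "\<not> ?many" by blast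
  next
    assume "\<not> ?many"
    then have "finite X" using infinite_arbitrarily_large by blast
    moreover have "\<not> Suc M \<le> card X"
    proof
      assume "Suc M \<le> card X"
      then obtain F where "F \<subseteq> X" "card F = Suc M" "finite F" by (rule obtain_subset_with_card_n)
      then show False using \<open>\<not> ?many\<close> by blast
    qed
    ultimately show ?few by simp
  qed
  have "{L \<in> lattice_space. finite (L \<inter> U) \<and> card (L \<inter> U) \<le> M} =
      space lattice_borel - {L \<in> lattice_space. \<exists>F\<subseteq>L \<inter> U. finite F \<and> card F = Suc M}"
    unfolding space_lattice_borel few_iff by blast
  then show ?thesis using sets_many_lattice_points[OF assms, of "Suc M"] by simp
qed

section \<open>Invariance of the measure and averages over finite families of matrices\<close>

lemma space_invariant_probability:
  assumes "invariant_probability \<mu>"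
  shows "space \<mu> = lattice_space"
  using assms sets_eq_imp_space_eq[of \<mu> lattice_borel]
  by (simp add: invariant_probability_def space_lattice_borel)

text \<open>Measurability of the image comes from invariance itself: a non-measurable set has
  \<open>emeasure\<close> 0, whereas a measurable set or its complement has positive measure.\<close>

lemma sets_image_SL:
  assumes \<mu>: "invariant_probability \<mu>" and h: "h \<in> SL" and A: "A \<in> sets \<mu>"
  shows "(\<lambda>L. (*v) h ` L) ` A \<in> sets \<mu>"
proof -
  interpret prob_space \<mu> using \<mu> by (simp add: invariant_probability_def)
  let ?h = "\<lambda>L. (*v) h ` L"
  have em: "emeasure \<mu> (?h ` B) = emeasure \<mu> B" if "B \<in> sets \<mu>" for B
    using \<mu> h that by (auto simp: invariant_probability_def)
  obtain h' where h': "h' \<in> SL" "h' ** h = mat 1" "h ** h' = mat 1" using SL_inverse[OF h] .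
  have sp: "space \<mu> = lattice_space" by (rule space_invariant_probability[OF \<mu>])
  \<comment> \<open>The action of h is a bijection of the space, so it suffices that the image of A
    or that of its complement is measurable.\<close>
  have compl: "?h ` (space \<mu> - A) = space \<mu> - ?h ` A"
  proof (intro equalityI subsetI)
    fix L assume "L \<in> ?h ` (space \<mu> - A)"
    then obtain L' where L': "L = ?h L'" "L' \<in> space \<mu>" "L' \<notin> A" by auto
    then have "L \<notin> ?h ` A" using SL_image_cancel[OF h'(2)] by (metis imageE)
    then show "L \<in> space \<mu> - ?h ` A" using L' lattice_space_image[OF h] sp by auto
  next
    fix L assume "L \<in> space \<mu> - ?h ` A"
    then have "L = ?h ((*v) h' ` L)" "(*v) h' ` L \<in> space \<mu>" "(*v) h' ` L \<notin> A"
      using SL_image_cancel[OF h'(3), of L] lattice_space_image[OF h'(1), of L] sp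
      by (simp_all, metis imageI)
    then show "L \<in> ?h ` (space \<mu> - A)" by blast
  qed
  have "?h ` A \<subseteq> space \<mu>"
    using sets.sets_into_space[OF A] lattice_space_image[OF h] sp by auto
  then have *: "?h ` A = space \<mu> - ?h ` (space \<mu> - A)"
    unfolding compl by (simp only: double_diff[OF _ order_refl])
  show ?thesis
  proof (cases "emeasure \<mu> A = 0")
    case True
    then have "emeasure \<mu> (space \<mu> - A) \<noteq> 0"
      using A emeasure_compl[of A \<mu>] emeasure_space_1 by simp
    then have "emeasure \<mu> (?h ` (space \<mu> - A)) \<noteq> 0" using em A by simp
    then have "?h ` (space \<mu> - A) \<in> sets \<mu>" using emeasure_notin_sets by blast
    then show ?thesis using * by (metis sets.compl_sets)
  next
    case False
    then show ?thesis using em[OF A] emeasure_notin_sets by metis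
  qed
qed

text \<open>The preimage under h is the image under the inverse of h, to which invariance
  applies.\<close>

lemma vimage_SL:
  assumes \<mu>: "invariant_probability \<mu>" and h: "h \<in> SL" and A: "A \<in> sets \<mu>"
  shows "{L \<in> space \<mu>. (*v) h ` L \<in> A} \<in> sets \<mu>"
    and "measure \<mu> {L \<in> space \<mu>. (*v) h ` L \<in> A} = measure \<mu> A"
proof -
  obtain h' where h': "h' \<in> SL" "h' ** h = mat 1" "h ** h' = mat 1" using SL_inverse[OF h] .
  have sp: "space \<mu> = lattice_space" by (rule space_invariant_probability[OF \<mu>])
  have "{L \<in> space \<mu>. (*v) h ` L \<in> A} = (\<lambda>L. (*v) h' ` L) ` A"
  proof (intro equalityI subsetI)
    fix L assume "L \<in> {L \<in> space \<mu>. (*v) h ` L \<in> A}"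
    then show "L \<in> (\<lambda>L. (*v) h' ` L) ` A"
      using SL_image_cancel[OF h'(2), of L] by (metis (mono_tags, lifting) image_eqI mem_Collect_eq)
  next
    fix L assume "L \<in> (\<lambda>L. (*v) h' ` L) ` A"
    then obtain L' where L': "L = (*v) h' ` L'" "L' \<in> A" by auto
    then have "(*v) h ` L = L'" using SL_image_cancel[OF h'(3), of L'] by simp
    moreover have "L \<in> space \<mu>"
      using L' sets.sets_into_space[OF A] lattice_space_image[OF h'(1), of L'] sp by auto
    ultimately show "L \<in> {L \<in> space \<mu>. (*v) h ` L \<in> A}" using L' by simp
  qed
  moreover have "emeasure \<mu> ((\<lambda>L. (*v) h' ` L) ` A) = emeasure \<mu> A"
    using \<mu> h' A by (auto simp: invariant_probability_def)
  ultimately show "{L \<in> space \<mu>. (*v) h ` L \<in> A} \<in> sets \<mu>"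
    and "measure \<mu> {L \<in> space \<mu>. (*v) h ` L \<in> A} = measure \<mu> A"
    using sets_image_SL[OF \<mu> h'(1) A] by (auto simp: measure_def)
qed

text \<open>Exchange sum and integral; by invariance every matrix \<open>h a\<close> contributes
  \<open>measure \<mu> Y\<close>.\<close>

lemma integral_orbit_count:
  fixes h :: "'b \<Rightarrow> ('a::{field,finite} fls) ^ 'd ^ 'd"
  assumes \<mu>: "invariant_probability \<mu>" and I: "finite I" "\<And>a. a \<in> I \<Longrightarrow> h a \<in> SL"
    and Y: "Y \<in> sets \<mu>"
  shows "integrable \<mu> (\<lambda>L. real (card {a \<in> I. (*v) (h a) ` L \<in> Y}))"
    and "(\<integral>L. real (card {a \<in> I. (*v) (h a) ` L \<in> Y}) \<partial>\<mu>) = real (card I) * measure \<mu> Y"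
proof -
  interpret prob_space \<mu> using \<mu> by (simp add: invariant_probability_def)
  let ?V = "\<lambda>a. {L \<in> space \<mu>. (*v) (h a) ` L \<in> Y}"
  have eq: "real (card {a \<in> I. (*v) (h a) ` L \<in> Y}) = (\<Sum>a\<in>I. indicator (?V a) L)" if "L \<in> space \<mu>" for L
    using that I(1) by (simp add: indicator_def sum.If_cases Int_def)
  have int: "integrable \<mu> (\<lambda>L. indicator (?V a) L :: real)" if "a \<in> I" for a
    using vimage_SL(1)[OF \<mu> I(2)[OF that] Y] by (simp add: integrable_indicator_iff emeasure_eq_measure)
  show "integrable \<mu> (\<lambda>L. real (card {a \<in> I. (*v) (h a) ` L \<in> Y}))"
    by (subst Bochner_Integration.integrable_cong[OF refl eq]) (use int in auto)
  have "(\<integral>L. real (card {a \<in> I. (*v) (h a) ` L \<in> Y}) \<partial>\<mu>) = (\<integral>L. (\<Sum>a\<in>I. indicator (?V a) L) \<partial>\<mu>)"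
    by (rule Bochner_Integration.integral_cong[OF refl eq])
  also have "\<dots> = (\<Sum>a\<in>I. measure \<mu> (?V a))"
    using int by (subst Bochner_Integration.integral_sum) (auto simp: Int_def cong: conj_cong)
  also have "\<dots> = (\<Sum>a\<in>I. measure \<mu> Y)"
    by (intro sum.cong refl vimage_SL \<mu> I Y)
  finally show "(\<integral>L. real (card {a \<in> I. (*v) (h a) ` L \<in> Y}) \<partial>\<mu>) = real (card I) * measure \<mu> Y"
    by simp
qed

text \<open>Integrate the pointwise bound on the proportion of matrices that move L into Y. This
  lemma and its upper counterpart turn counts of shears into bounds on measures.\<close>

lemma measure_ge_orbit_average:
  fixes h :: "'b \<Rightarrow> ('a::{field,finite} fls) ^ 'd ^ 'd"
  assumes \<mu>: "invariant_probability \<mu>" and I: "finite I" "I \<noteq> {}" "\<And>a. a \<in> I \<Longrightarrow> h a \<in> SL"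
    and Y: "Y \<in> sets \<mu>" and S: "S \<in> sets \<mu>"
    and le: "\<And>L. L \<in> S \<Longrightarrow> p * real (card I) \<le> real (card {a \<in> I. (*v) (h a) ` L \<in> Y})"
  shows "p * measure \<mu> S \<le> measure \<mu> Y"
proof -
  interpret prob_space \<mu> using \<mu> by (simp add: invariant_probability_def)
  note oc = integral_orbit_count[OF \<mu> I(1,3) Y]
  have "(p * real (card I)) * measure \<mu> S = (\<integral>L. p * real (card I) * indicator S L \<partial>\<mu>)"
    using S by simp
  also have "\<dots> \<le> (\<integral>L. real (card {a \<in> I. (*v) (h a) ` L \<in> Y}) \<partial>\<mu>)"
    using S le oc(1)
    by (intro integral_mono integrable_mult_right integrable_real_indicator)
       (auto simp: indicator_def emeasure_eq_measure)
  also have "\<dots> = real (card I) * measure \<mu> Y" by (rule oc(2))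
  finally have "real (card I) * (p * measure \<mu> S) \<le> real (card I) * measure \<mu> Y" by (simp add: mult_ac)
  moreover have "real (card I) > 0" using I by (simp add: card_gt_0_iff)
  ultimately show ?thesis by simp
qed

lemma measure_le_orbit_average:
  fixes h :: "'b \<Rightarrow> ('a::{field,finite} fls) ^ 'd ^ 'd"
  assumes \<mu>: "invariant_probability \<mu>" and I: "finite I" "I \<noteq> {}" "\<And>a. a \<in> I \<Longrightarrow> h a \<in> SL"
    and Y: "Y \<in> sets \<mu>"
    and le: "\<And>L. L \<in> space \<mu> \<Longrightarrow> real (card {a \<in> I. (*v) (h a) ` L \<in> Y}) \<le> q * real (card I)"
  shows "measure \<mu> Y \<le> q"
proof -
  interpret prob_space \<mu> using \<mu> by (simp add: invariant_probability_def)
  note oc = integral_orbit_count[OF \<mu> I(1,3) Y]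
  have "real (card I) * measure \<mu> Y = (\<integral>L. real (card {a \<in> I. (*v) (h a) ` L \<in> Y}) \<partial>\<mu>)"
    by (rule oc(2)[symmetric])
  also have "\<dots> \<le> (\<integral>L. q * real (card I) \<partial>\<mu>)"
    using le oc(1) by (intro integral_mono) auto
  finally have "real (card I) * measure \<mu> Y \<le> real (card I) * q" by (simp add: prob_space mult_ac)
  moreover have "real (card I) > 0" using I by (simp add: card_gt_0_iff)
  ultimately show ?thesis by simp
qed

section \<open>Borel--Cantelli arguments and condensation\<close>

lemma (in prob_space) ex_prob_ge_of_incseq:
  assumes "range A \<subseteq> events" "incseq A" "\<epsilon> > 0"
  shows "\<exists>n. prob (\<Union>i. A i) - \<epsilon> \<le> prob (A n)"
proof -
  have "(\<lambda>n. prob (A n)) \<longlonglongrightarrow> prob (\<Union>i. A i)"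
    using assms by (intro finite_Lim_measure_incseq)
  then have "\<forall>\<^sub>F n in sequentially. prob (\<Union>i. A i) - \<epsilon> < prob (A n)"
    using assms(3) by (intro order_tendstoD) auto
  then show ?thesis by (metis eventually_sequentially less_imp_le order_refl)
qed

text \<open>A Borel-Cantelli lemma without independence. For fixed T the sets
  \<open>E j \<inter> S T j\<close> with \<open>T \<le> j\<close> are disjoint, so non-summability
  of p forces \<open>prob (S T j) < \<epsilon>\<close> for some j. Then the union of the
  \<open>E i\<close> with \<open>T \<le> i\<close> misses at most three sets of probability at most
  \<epsilon>: the complement of \<open>D j\<close>, the set \<open>S T j\<close> and the union of
  the \<open>Y i j\<close>.\<close>

lemma (in prob_space) prob_limsup_ge:
  fixes D E :: "nat \<Rightarrow> 'a set" and Y :: "nat \<Rightarrow> nat \<Rightarrow> 'a set" and p :: "nat \<Rightarrow> real"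
  defines "S \<equiv> \<lambda>T j. D j - (\<Union>i\<in>{T..<j}. E i \<union> Y i j)"
  assumes D: "\<And>j. D j \<in> events" and E: "\<And>j. E j \<in> events" and Y: "\<And>i j. Y i j \<in> events"
    and prob_D: "\<And>j. 1 - \<epsilon> \<le> prob (D j)"
    and prob_Y: "\<And>j. (\<Sum>i<j. prob (Y i j)) \<le> \<epsilon>"
    and prob_E: "\<And>T j. T \<le> j \<Longrightarrow> p j * prob (S T j) \<le> prob (E j \<inter> S T j)"
    and p: "\<And>j. 0 \<le> p j" "\<not> summable p" and eps: "0 < \<epsilon>"
  shows "1 - 3 * \<epsilon> \<le> prob (\<Inter>T. \<Union>i\<in>{T..}. E i)"
proof -
  have S: "S T j \<in> events" for T j
    using D E Y by (auto simp: S_def)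
  have tail: "1 - 3 * \<epsilon> \<le> prob (\<Union>i\<in>{T..}. E i)" for T
  proof -
    have "\<exists>j\<ge>T. prob (S T j) < \<epsilon>"
    proof (rule ccontr)
      assume "\<not> ?thesis"
      then have large: "\<epsilon> \<le> prob (S T j)" if "T \<le> j" for j using that by force
      have disj: "disjoint_family (\<lambda>j. E (j + T) \<inter> S T (j + T))"
      proof -
        have "(E i \<inter> S T i) \<inter> (E j \<inter> S T j) = {}" if "T \<le> i" "i < j" for i j
          using that by (auto simp: S_def)
        then show ?thesis
          unfolding disjoint_family_on_def by (metis Int_commute add_le_cancel_right le_add2 linorder_neqE_nat not_less)
      qed
      have "summable (\<lambda>j. p (j + T))"
      proof (rule summableI_nonneg_bounded)
        fix n
        have "(\<Sum>j<n. p (j + T)) * \<epsilon> \<le> (\<Sum>j<n. prob (E (j + T) \<inter> S T (j + T)))"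
          unfolding sum_distrib_right
        proof (rule sum_mono)
          fix j
          have "p (j + T) * \<epsilon> \<le> p (j + T) * prob (S T (j + T))"
            using large[of "j + T"] p(1)[of "j + T"] by (intro mult_left_mono) auto
          also have "\<dots> \<le> prob (E (j + T) \<inter> S T (j + T))" by (rule prob_E) simp
          finally show "p (j + T) * \<epsilon> \<le> prob (E (j + T) \<inter> S T (j + T))" .
        qed
        also have "\<dots> = prob (\<Union>j<n. E (j + T) \<inter> S T (j + T))"
          using E S disj by (intro finite_measure_finite_Union[symmetric])
            (auto intro: disjoint_family_on_mono[OF subset_UNIV])
        also have "\<dots> \<le> 1" by simp
        finally show "(\<Sum>j<n. p (j + T)) \<le> 1 / \<epsilon>" using eps by (simp add: field_simps)
      qed (rule p)
      then show False using p(2) by (simp add: summable_iff_shift)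
    qed
    then obtain j where j: "T \<le> j" "prob (S T j) < \<epsilon>" by blast
    have E': "(\<Union>i\<in>{T..}. E i) \<in> events" using E by auto
    have "1 = prob (space M)" by (simp add: prob_space)
    also have "\<dots> \<le> prob ((space M - D j) \<union> (S T j \<union> ((\<Union>i\<in>{T..}. E i) \<union> (\<Union>i<j. Y i j))))"
      using D E Y S E' by (intro finite_measure_mono) (auto simp: S_def)
    also have "\<dots> \<le> prob (space M - D j) + (prob (S T j) + (prob (\<Union>i\<in>{T..}. E i) + prob (\<Union>i<j. Y i j)))"
      using D E Y S E'
      by (intro order_trans[OF measure_Un_le] add_left_mono order_refl) auto
    also have "prob (space M - D j) \<le> \<epsilon>" using prob_D[of j] D by (simp add: prob_compl)
    also have "prob (\<Union>i<j. Y i j) \<le> \<epsilon>"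
      using Y by (intro order_trans[OF finite_measure_subadditive_finite prob_Y]) auto
    finally show ?thesis using j by simp
  qed
  \<comment> \<open>The bound does not depend on T, so it passes to the decreasing limit.\<close>
  have "decseq (\<lambda>T. \<Union>i\<in>{T..}. E i)"
    unfolding decseq_def by (intro allI impI UN_mono) auto
  then have "(\<lambda>T. prob (\<Union>i\<in>{T..}. E i)) \<longlonglongrightarrow> prob (\<Inter>T. \<Union>i\<in>{T..}. E i)"
    using E by (intro finite_Lim_measure_decseq) auto
  then show ?thesis using tail by (intro LIMSEQ_le_const) auto
qed

text \<open>Take the least b with \<open>p ^ b \<le> y\<close>. If b is positive, the preceding
  power exceeds y; the minimum with 1 covers b = 0.\<close>

lemma ex_power_close_below:
  fixes p y :: real
  assumes p: "0 < p" "p < 1" and y: "0 < y"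
  shows "\<exists>b. p ^ b \<le> y \<and> min 1 (p * y) \<le> p ^ b"
proof -
  obtain n where n: "p ^ n < y" using real_arch_pow_inv[OF y p(2)] by blast
  define b where "b = (LEAST b. p ^ b \<le> y)"
  have b: "p ^ b \<le> y" unfolding b_def by (rule LeastI[of _ n]) (use n in simp)
  have "min 1 (p * y) \<le> p ^ b"
  proof (cases b)
    case (Suc c)
    then have "\<not> p ^ c \<le> y" unfolding b_def by (metis Suc_n_not_le_n Least_le)
    then show ?thesis using Suc p by (simp add: min_le_iff_disj mult_left_mono)
  qed simp
  with b show ?thesis by blast
qed

text \<open>The terms of a convergent series tend to 0, so the truncation at 1 is eventually
  inactive.\<close>

lemma not_summable_min_one:
  fixes x :: "nat \<Rightarrow> real"
  assumes c: "0 < c" and x: "\<not> summable x"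
  shows "\<not> summable (\<lambda>t. min 1 (c * x t))"
proof
  assume s: "summable (\<lambda>t. min 1 (c * x t))"
  then have "(\<lambda>t. min 1 (c * x t)) \<longlonglongrightarrow> 0" by (rule summable_LIMSEQ_zero)
  then have "\<forall>\<^sub>F t in sequentially. min 1 (c * x t) < 1" by (rule order_tendstoD) simp
  then have "\<forall>\<^sub>F t in sequentially. min 1 (c * x t) = c * x t" by eventually_elim auto
  then have "summable (\<lambda>t. c * x t)" using s by (simp add: summable_cong)
  then show False using c x by simp
qed

text \<open>Cauchy condensation: the block of indices from \<open>K Q^t\<close> to
  \<open>K Q^(t+1)\<close> has at most \<open>K Q^(t+1)\<close> terms, each at most the value of
  \<psi> at \<open>K Q^t\<close>.\<close>

lemma not_summable_condensed:
  fixes \<psi> :: "real \<Rightarrow> real" and K Q :: nat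
  assumes nn: "\<And>x. 0 < x \<Longrightarrow> 0 \<le> \<psi> x" and anti: "antimono_on {0<..} \<psi>"
    and div: "\<not> summable (\<lambda>x. \<psi> (real (Suc x)))" and K: "1 \<le> K" and Q: "2 \<le> Q"
  shows "\<not> summable (\<lambda>t. real Q ^ t * \<psi> (real K * real Q ^ t))"
proof
  let ?f = "\<lambda>t. real Q ^ t * \<psi> (real K * real Q ^ t)"
  let ?g = "\<lambda>x. \<psi> (real (Suc x))"
  assume s: "summable ?f"
  have f: "0 \<le> ?f t" for t using K Q nn by auto
  have partial: "(\<Sum>x<K * Q ^ T. ?g x) \<le> (\<Sum>x<K. ?g x) + K * Q * (\<Sum>t<T. ?f t)" for T
  proof (induction T)
    case (Suc T)
    have le: "K * Q ^ T \<le> K * Q ^ Suc T" using Q by simp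
    have "(\<Sum>x<K * Q ^ Suc T. ?g x) = (\<Sum>x<K * Q ^ T. ?g x) + (\<Sum>x\<in>{K * Q ^ T..<K * Q ^ Suc T}. ?g x)"
      using le by (simp only: lessThan_atLeast0 sum.atLeastLessThan_concat)
    also have "(\<Sum>x\<in>{K * Q ^ T..<K * Q ^ Suc T}. ?g x) \<le>
        of_nat (card {K * Q ^ T..<K * Q ^ Suc T}) * \<psi> (real K * real Q ^ T)"
    proof (rule sum_bounded_above)
      fix x assume "x \<in> {K * Q ^ T..<K * Q ^ Suc T}"
      then have "real (K * Q ^ T) \<le> real (Suc x)" by (subst of_nat_le_iff) auto
      then show "?g x \<le> \<psi> (real K * real Q ^ T)"
        using K Q by (intro monotone_onD[OF anti]) auto
    qed
    also have "\<dots> \<le> real (K * Q ^ Suc T) * \<psi> (real K * real Q ^ T)"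
      using K Q nn by (intro mult_right_mono) auto
    also have "\<dots> = K * Q * ?f T" by (simp add: mult_ac)
    finally show ?case using Suc.IH by (simp add: distrib_left)
  qed simp
  have "summable ?g"
  proof (rule summableI_nonneg_bounded)
    fix n
    have "n \<le> K * Q ^ n"
      using K Q less_exp[of n] power_mono[of 2 Q n] mult_le_mono[of 1 K n "Q ^ n"] by simp
    then have "(\<Sum>x<n. ?g x) \<le> (\<Sum>x<K * Q ^ n. ?g x)"
      using nn by (intro sum_mono2) auto
    also have "\<dots> \<le> (\<Sum>x<K. ?g x) + K * Q * (\<Sum>t<n. ?f t)" by (rule partial)
    also have "\<dots> \<le> (\<Sum>x<K. ?g x) + K * Q * suminf ?f"
      using sum_le_suminf[OF s, of "{..<n}"] f by (intro add_left_mono mult_left_mono) auto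
    finally show "(\<Sum>x<n. ?g x) \<le> (\<Sum>x<K. ?g x) + K * Q * suminf ?f" .
  qed (use nn in simp)
  then show False using div by simp
qed

text \<open>A zero of \<psi> would force \<psi> to vanish from there on and leave a finite
  sum.\<close>

lemma pos_of_not_summable:
  fixes \<psi> :: "real \<Rightarrow> real"
  assumes nn: "\<And>x. 0 < x \<Longrightarrow> 0 \<le> \<psi> x" and anti: "antimono_on {0<..} \<psi>"
    and div: "\<not> summable (\<lambda>x. \<psi> (real (Suc x)))" and y: "0 < y"
  shows "0 < \<psi> y"
proof (rule ccontr)
  assume "\<not> 0 < \<psi> y"
  then have 0: "\<psi> x = 0" if "y \<le> x" for x
    using monotone_onD[OF anti, of y x] nn[of x] that y by auto
  obtain n :: nat where n: "y \<le> real n" using real_arch_simple by blast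
  then have "\<forall>\<^sub>F x in sequentially. \<psi> (real (Suc x)) = 0"
    by (intro eventually_sequentiallyI[of n] 0) linarith
  then show False using div summable_cong[of "\<lambda>x. \<psi> (real (Suc x))" "\<lambda>_. 0"] by simp
qed

lemma sum_geometric_tail_le:
  fixes r :: real
  assumes "0 \<le> r" "r \<le> 1 / 2"
  shows "(\<Sum>i<j. r ^ (j - i)) \<le> 2 * r"
proof (induction j)
  case (Suc j)
  have "(\<Sum>i<Suc j. r ^ (Suc j - i)) = r * (\<Sum>i<j. r ^ (j - i)) + r"
    by (simp add: sum_distrib_left Suc_diff_le)
  also have "\<dots> \<le> 1 / 2 * (2 * r) + r"
    using Suc.IH assms by (intro add_right_mono mult_mono) (auto intro: sum_nonneg)
  finally show ?case by simp
qed (use assms in simp)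

section \<open>Shears, flow and windows\<close>

text \<open>A unipotent matrix. It fixes the lower coordinates and, when \<open>v $ Inr j\<close> is
  nonzero, translates the ratios \<open>v $ Inl i / v $ Inr j\<close> by
  \<open>a $ i\<close>.\<close>

definition shear :: "'n::finite \<Rightarrow> 'a::{field,finite} fls ^ 'm::finite \<Rightarrow> ('a fls) ^ ('m + 'n) ^ ('m + 'n)" where
  "shear j a = (\<chi> r c. if c = Inr j then (case r of Inl i \<Rightarrow> a $ i | Inr k \<Rightarrow> if k = j then 1 else 0)
     else if r = c then 1 else 0)"

lemma shear_in_SL: "shear j a \<in> SL"
proof -
  define x where "x = (\<chi> r. case r of Inl i \<Rightarrow> a $ i | Inr k \<Rightarrow> if k = j then 1 else 0)"
  \<comment> \<open>The shear is the identity with one column replaced, so Cramer's lemma reduces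
    its determinant to the diagonal entry of that column, which is 1.\<close>
  have "shear j a = (\<chi> r c. if c = Inr j then (mat 1 *v x) $ r else mat 1 $ r $ c)"
    unfolding matrix_vector_mul_lid by (auto simp: shear_def vec_eq_iff x_def mat_def)
  then have "det (shear j a) = x $ Inr j * det (mat 1 :: 'a fls ^ ('b + 'c) ^ ('b + 'c))"
    by (simp only: cramer_lemma)
  then show ?thesis by (simp add: SL_def x_def)
qed

lemma shear_apply:
  "(shear j a *v v) $ Inl i = v $ Inl i + a $ i * v $ Inr j"
  "(shear j a *v v) $ Inr k = v $ Inr k"
proof -
  have "shear j a $ Inl i $ c = (if c = Inl i then 1 else 0) + (if c = Inr j then a $ i else 0)" for c
    by (simp add: shear_def)
  then show "(shear j a *v v) $ Inl i = v $ Inl i + a $ i * v $ Inr j"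
    by (simp add: matrix_vector_mult_def distrib_right sum.distrib if_distrib[of "\<lambda>x. x * _"] cong: if_cong)
  have "shear j a $ Inr k $ c = (if c = Inr k then 1 else 0)" for c
    by (auto simp: shear_def)
  then show "(shear j a *v v) $ Inr k = v $ Inr k"
    by (simp add: matrix_vector_mult_def if_distrib[of "\<lambda>x. x * _"] cong: if_cong)
qed

text \<open>As \<open>fls_X\<close> is the inverse of X, the upper entries are \<open>X^(nt)\<close>
  and the lower ones \<open>X^(-mt)\<close>; over m and n rows the exponents cancel.\<close>

definition flow :: "int \<Rightarrow> ('a::{field,finite} fls) ^ ('m::finite + 'n::finite) ^ ('m + 'n)" where
  "flow t = (\<chi> r c. if r = c then
     (case r of Inl _ \<Rightarrow> fls_X_intpow (- (int CARD('n) * t)) | Inr _ \<Rightarrow> fls_X_intpow (int CARD('m) * t))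
     else 0)"

lemma flow_in_SL: "(flow t :: ('a::{field,finite} fls) ^ ('m::finite + 'n::finite) ^ ('m + 'n)) \<in> SL"
proof -
  have "det (flow t :: ('a fls) ^ ('m + 'n) ^ ('m + 'n)) =
      (\<Prod>r\<in>(UNIV :: 'm set) <+> (UNIV :: 'n set). case r of Inl _ \<Rightarrow> fls_X_intpow (- (int CARD('n) * t)) | Inr _ \<Rightarrow> fls_X_intpow (int CARD('m) * t))"
    by (subst det_diagonal) (auto simp: flow_def intro!: prod.cong)
  also have "\<dots> = (\<Prod>r\<in>(UNIV :: 'm set). fls_X_intpow (- (int CARD('n) * t))) *
      (\<Prod>r\<in>(UNIV :: 'n set). fls_X_intpow (int CARD('m) * t))"
    by (subst prod.Plus) simp_all
  also have "\<dots> = fls_X_intpow (int CARD('m) * (- (int CARD('n) * t))) * fls_X_intpow (int CARD('n) * (int CARD('m) * t))"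
    by (simp only: prod_constant fls_X_intpow_power)
  also have "\<dots> = 1"
    by (simp only: fls_X_intpow_times_fls_X_intpow) (simp add: mult_ac)
  finally show ?thesis by (simp add: SL_def)
qed

lemma flow_apply:
  fixes v :: "('a::{field,finite} fls) ^ ('m::finite + 'n::finite)"
  shows "(flow t *v v) $ Inl i = fls_X_intpow (- (int CARD('n) * t)) * v $ Inl i"
    "(flow t *v v) $ Inr k = fls_X_intpow (int CARD('m) * t) * v $ Inr k"
proof -
  let ?d = "\<lambda>r :: 'm + 'n. case r of Inl _ \<Rightarrow> fls_X_intpow (- (int CARD('n) * t)) :: 'a fls
     | Inr _ \<Rightarrow> fls_X_intpow (int CARD('m) * t)"
  have "flow t $ r $ c = (if c = r then ?d r else 0)" for r c
    by (auto simp: flow_def)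
  then have "(flow t *v v) $ r = ?d r * v $ r" for r
    by (simp add: matrix_vector_mult_def if_distrib[of "\<lambda>x. x * _"] cong: if_cong)
  then show "(flow t *v v) $ Inl i = fls_X_intpow (- (int CARD('n) * t)) * v $ Inl i"
    "(flow t *v v) $ Inr k = fls_X_intpow (int CARD('m) * t) * v $ Inr k"
    by simp_all
qed

text \<open>
  \<open>low_box \<kappa> t j\<close> bounds the norm of the last n coordinates by \<open>s^(mt + \<kappa>)\<close>, where s is the order
  of the finite field, and the absolute value of the j-th of them from below by \<open>s^(mt - \<kappa>)\<close>.  In
  \<open>window\<close> the bound on the ratios is chosen such that the flow for time t takes the window at
  time t to the window at time 0.
\<close>

definition low_box :: "int \<Rightarrow> int \<Rightarrow> 'n::finite \<Rightarrow> ('a::{field,finite} fls ^ ('m::finite + 'n)) set" where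
  "low_box \<kappa> t j = {v. (\<forall>k. vanishes_below (- (int CARD('m) * t) - \<kappa>) (v $ Inr k)) \<and>
     \<not> vanishes_below (\<kappa> + 1 - int CARD('m) * t) (v $ Inr j)}"

text \<open>The ratios are bounded instead of the upper coordinates because shears act on ratios by
  translation.\<close>

definition cone_box :: "int \<Rightarrow> int \<Rightarrow> 'n::finite \<Rightarrow> int \<Rightarrow> ('a::{field,finite} fls ^ ('m::finite + 'n)) set" where
  "cone_box \<kappa> t j \<gamma> = {v \<in> low_box \<kappa> t j. \<forall>i. vanishes_below \<gamma> (v $ Inl i / v $ Inr j)}"

definition window :: "int \<Rightarrow> int \<Rightarrow> 'n::finite \<Rightarrow> ('a::{field,finite} fls ^ ('m::finite + 'n)) set" where
  "window \<kappa> t j = cone_box \<kappa> t j (int (CARD('m) + CARD('n)) * t - \<kappa>)"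

section \<open>Cones and windows under shears and flow, and their lattice points\<close>

lemma low_box_nonzero: "v \<in> low_box \<kappa> t j \<Longrightarrow> v $ Inr j \<noteq> 0"
  by (auto simp: low_box_def)

lemma cone_box_mono: "\<gamma> \<le> \<delta> \<Longrightarrow> cone_box \<kappa> t j \<delta> \<subseteq> cone_box \<kappa> t j \<gamma>"
  by (auto simp: cone_box_def intro: vanishes_below_mono)

lemma shear_mem_cone_box:
  "shear j a *v v \<in> cone_box \<kappa> t j \<gamma> \<longleftrightarrow>
     v \<in> low_box \<kappa> t j \<and> (\<forall>i. vanishes_below \<gamma> (v $ Inl i / v $ Inr j + a $ i))"
  using low_box_nonzero[of v \<kappa> t j]
  by (auto simp: cone_box_def low_box_def shear_apply add_divide_distrib)

text \<open>The ball of index \<gamma> is a subgroup, so translations by its elements preserve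
  it.\<close>

lemma shear_mem_cone_box_iff:
  assumes "\<And>i. vanishes_below \<gamma> (a $ i)"
  shows "shear j a *v v \<in> cone_box \<kappa> t j \<gamma> \<longleftrightarrow> v \<in> cone_box \<kappa> t j \<gamma>"
  unfolding shear_mem_cone_box using assms
  by (simp add: vanishes_below_add_cancel cone_box_def)

text \<open>The flow multiplies the lower coordinates by \<open>X^(-mt)\<close> and the ratios by
  \<open>X^((m+n)t)\<close>; this accounts for the shifts of the time and of \<gamma>.\<close>

lemma flow_mem_cone_box:
  fixes v :: "('a::{field,finite} fls) ^ ('m::finite + 'n::finite)"
  shows "flow t *v v \<in> cone_box \<kappa> 0 j \<gamma> \<longleftrightarrow> v \<in> cone_box \<kappa> t j (\<gamma> + int (CARD('m) + CARD('n)) * t)"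
proof -
  have low: "flow t *v v \<in> low_box \<kappa> 0 j \<longleftrightarrow> v \<in> low_box \<kappa> t j"
    by (simp add: low_box_def flow_apply vanishes_below_shift_mult minus_diff_commute)
  have "vanishes_below \<gamma> ((flow t *v v) $ Inl i / (flow t *v v) $ Inr j) \<longleftrightarrow>
      vanishes_below (\<gamma> + int (CARD('m) + CARD('n)) * t) (v $ Inl i / v $ Inr j)"
    if "v \<in> low_box \<kappa> t j" for i
  proof -
    have "v $ Inr j \<noteq> 0" using low_box_nonzero[OF that] .
    then show ?thesis
      by (simp add: flow_apply vanishes_below_divide_iff vanishes_below_shift_mult
          fls_subdegree_mult_fls_X_intpow)
        (simp add: algebra_simps)
  qed
  with low show ?thesis by (auto simp: cone_box_def)
qed

lemma flow_mem_window: "flow t *v v \<in> window \<kappa> 0 j \<longleftrightarrow> v \<in> window \<kappa> t j"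
  by (simp add: window_def flow_mem_cone_box)

text \<open>A change from a large enough index N on preserves the valuation of the coordinate
  \<open>Inr j\<close>. The conditions on the ratios then concern coefficients of the numerators
  below N only.\<close>

lemma locally_constant_cone_box:
  fixes j :: "'n::finite"
  shows "locally_constant_set (cone_box \<kappa> t j \<gamma> :: ('a::{field,finite} fls ^ ('m::finite + 'n)) set)"
  unfolding locally_constant_set_def
proof
  fix v :: "'a fls ^ ('m + 'n)"
  assume v: "v \<in> cone_box \<kappa> t j \<gamma>"
  define l where "l = v $ Inr j"
  define d where "d = fls_subdegree l"
  define N where "N = max (d + 1) (max (- (int CARD('m) * t) - \<kappa>) (max (\<kappa> + 1 - int CARD('m) * t) (\<gamma> + d)))"
  have l: "l \<noteq> 0" using v low_box_nonzero by (auto simp: cone_box_def l_def)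
  have "v' \<in> cone_box \<kappa> t j \<gamma>" if v': "\<forall>r. vanishes_below N (v' $ r - v $ r)" for v'
  proof -
    have iff: "vanishes_below M (v' $ r) \<longleftrightarrow> vanishes_below M (v $ r)" if "M \<le> N" for M r
      using vanishes_below_add_cancel[OF vanishes_below_mono[OF v'[rule_format] that], of "v $ r" r] by simp
    have "d + 1 \<le> N" by (simp add: N_def)
    moreover have "vanishes_below d l" "\<not> vanishes_below (d + 1) l"
      using l by (auto simp: vanishes_below_iff d_def)
    ultimately have "vanishes_below d (v' $ Inr j)" "\<not> vanishes_below (d + 1) (v' $ Inr j)"
      by (simp_all add: iff l_def)
    then have l': "v' $ Inr j \<noteq> 0" "fls_subdegree (v' $ Inr j) = d"
      by (auto simp: vanishes_below_iff)
    show ?thesis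
      using v l l'
      by (auto simp: cone_box_def low_box_def iff N_def vanishes_below_divide_iff l_def d_def)
  qed
  then show "\<exists>N. \<forall>v'. (\<forall>r. vanishes_below N (v' $ r - v $ r)) \<longrightarrow> v' \<in> cone_box \<kappa> t j \<gamma>" by blast
qed

text \<open>Applying the inverse matrix to a bounded lattice vector gives polynomials of bounded
  degree, and there are finitely many of these. The upper limit 1 of the digits expresses that
  polynomials have no coefficient of positive index.\<close>

lemma finite_lattice_bounded:
  fixes L :: "('a::{field,finite} fls ^ 'd) set"
  assumes "L \<in> lattice_space"
  shows "finite {v \<in> L. \<forall>i. vanishes_below N (v $ i)}"
proof -
  obtain g where g: "g \<in> SL" "L = lattice_of g" using assms by (auto simp: lattice_space_def)
  obtain g' where g': "g' \<in> SL" "g' ** g = mat 1" "g ** g' = mat 1" using SL_inverse[OF g(1)] .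
  define K where "K = Min (range (\<lambda>(i, j). fls_subdegree (g' $ i $ j)))"
  have K: "vanishes_below K (g' $ i $ j)" for i j
  proof -
    have "K \<le> fls_subdegree (g' $ i $ j)"
      unfolding K_def by (rule Min_le) (auto intro!: image_eqI[of _ _ "(i, j)"])
    then show ?thesis by (simp add: vanishes_below_iff)
  qed
  have "{v \<in> L. \<forall>i. vanishes_below N (v $ i)} \<subseteq> (*v) g ` {w. \<forall>i. w $ i \<in> digits (K + N) 1}"
  proof
    fix v assume "v \<in> {v \<in> L. \<forall>i. vanishes_below N (v $ i)}"
    then obtain w where w: "v = g *v w" "w \<in> poly_vecs" and v: "\<And>i. vanishes_below N (v $ i)"
      by (auto simp: g lattice_of_def)
    have "w = g' *v v" using SL_cancel[OF g'(2)] w by simp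
    then have "vanishes_below (K + N) (w $ i)" for i
      unfolding matrix_vector_mult_def using K v
      by (auto intro!: vanishes_below_sum vanishes_below_mult)
    moreover have "\<forall>k>0. fls_nth (w $ i) k = 0" for i
      using w(2) by (auto simp: poly_vecs_def poly_ring_iff)
    ultimately have "w $ i \<in> digits (K + N) 1" for i
      by (auto simp: digits_def vanishes_below_def)
    then show "v \<in> (*v) g ` {w. \<forall>i. w $ i \<in> digits (K + N) 1}" using w by blast
  qed
  then show ?thesis
    by (rule finite_subset) (intro finite_imageI card_vec_box card_digits)
qed

text \<open>An upper coordinate is its ratio times a bounded lower coordinate, so the cone is
  bounded.\<close>

lemma finite_lattice_cone_box:
  fixes L :: "('a::{field,finite} fls ^ ('m::finite + 'n::finite)) set"
  assumes "L \<in> lattice_space"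
  shows "finite (L \<inter> cone_box \<kappa> t j \<gamma>)"
proof (rule finite_subset)
  define N where "N = - (int CARD('m) * t) - \<kappa>"
  show "finite {v \<in> L. \<forall>i. vanishes_below (min N (\<gamma> + N)) (v $ i)}"
    by (rule finite_lattice_bounded[OF assms])
  show "L \<inter> cone_box \<kappa> t j \<gamma> \<subseteq> {v \<in> L. \<forall>i. vanishes_below (min N (\<gamma> + N)) (v $ i)}"
  proof (clarify)
    fix v i assume v: "v \<in> L" "v \<in> cone_box \<kappa> t j \<gamma>"
    show "vanishes_below (min N (\<gamma> + N)) (v $ i)"
    proof (cases i)
      case (Inr k)
      then show ?thesis using v vanishes_below_mono[of N "v $ i" "min N (\<gamma> + N)"]
        by (auto simp: cone_box_def low_box_def N_def)
    next
      case (Inl k)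
      have "v $ Inr j \<noteq> 0" using v low_box_nonzero by (auto simp: cone_box_def)
      then have "v $ Inl k = v $ Inl k / v $ Inr j * v $ Inr j" by simp
      moreover have "vanishes_below (\<gamma> + N) (v $ Inl k / v $ Inr j * v $ Inr j)"
        using v by (intro vanishes_below_mult) (auto simp: cone_box_def low_box_def N_def)
      ultimately have "vanishes_below (\<gamma> + N) (v $ i)" using Inl by simp
      then show ?thesis by (rule vanishes_below_mono) simp
    qed
  qed
qed

lemma window_mono: "\<kappa> \<le> \<kappa>' \<Longrightarrow> window \<kappa> t j \<subseteq> window \<kappa>' t j"
  by (auto simp: window_def cone_box_def low_box_def intro: vanishes_below_mono)

text \<open>Determinant 1 excludes a zero row, so some column of g, itself a lattice vector, has a
  nonzero coordinate \<open>Inr j\<close>; a large \<kappa> bounds all valuations involved.\<close>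

lemma lattice_meets_window:
  fixes L :: "('a::{field,finite} fls ^ ('m::finite + 'n::finite)) set"
  assumes "L \<in> lattice_space"
  shows "\<exists>\<kappa>::nat. L \<inter> window (int \<kappa>) 0 j \<noteq> {}"
proof -
  obtain g where g: "g \<in> SL" "L = lattice_of g" using assms by (auto simp: lattice_space_def)
  have "\<exists>c. g $ Inr j $ c \<noteq> 0"
  proof (rule ccontr)
    assume "\<not> ?thesis"
    then have "row (Inr j) g = 0" by (simp add: row_def vec_eq_iff)
    then have "det g = 0" by (rule det_zero_row)
    then show False using g by (simp add: SL_def)
  qed
  then obtain c where c: "g $ Inr j $ c \<noteq> 0" by blast
  define v where "v = g *v axis c 1"
  have vr: "v $ r = g $ r $ c" for r
    by (simp add: v_def matrix_vector_mult_def axis_def if_distrib cong: if_cong)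
  have "axis c 1 \<in> poly_vecs" by (simp add: poly_vecs_def axis_def poly_ring_closed)
  then have vL: "v \<in> L" by (auto simp: g v_def lattice_of_def)
  define A where "A = range (\<lambda>r. fls_subdegree (v $ r)) \<union> range (\<lambda>i. fls_subdegree (v $ Inl i / v $ Inr j))"
  define \<kappa> where "\<kappa> = nat (Max ((\<lambda>x. \<bar>x\<bar>) ` A))"
  have "\<bar>x\<bar> \<le> int \<kappa>" if "x \<in> A" for x
  proof -
    have "\<bar>x\<bar> \<le> Max ((\<lambda>x. \<bar>x\<bar>) ` A)" using that by (intro Max_ge) (auto simp: A_def)
    moreover from this have "0 \<le> Max ((\<lambda>x. \<bar>x\<bar>) ` A)" by (rule order_trans[OF abs_ge_zero])
    ultimately show ?thesis by (simp add: \<kappa>_def)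
  qed
  then have "\<bar>fls_subdegree (v $ r)\<bar> \<le> int \<kappa>" "\<bar>fls_subdegree (v $ Inl i / v $ Inr j)\<bar> \<le> int \<kappa>" for r i
    by (auto simp: A_def)
  note * = this[THEN abs_le_D1] this[THEN abs_le_D2]
  have "v \<in> window (int \<kappa>) 0 j"
    using c *(1)[of "Inr j"] *(3,4)
    by (auto simp: window_def cone_box_def low_box_def vanishes_below_iff vr minus_le_iff)
  then show ?thesis using vL by blast
qed

text \<open>The vector in the window yields the lower bound in \<open>measure_hit_Int_ge\<close>,
  the number M the upper bound in \<open>measure_hit_le\<close>. Finiteness is stated because
  \<open>card\<close> of an infinite set is 0.\<close>

definition crowd :: "int \<Rightarrow> nat \<Rightarrow> int \<Rightarrow> 'n::finite \<Rightarrow> ('a::{field,finite} fls ^ ('m::finite + 'n)) set set" where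
  "crowd \<kappa> M t j = {L \<in> lattice_space. L \<inter> window \<kappa> t j \<noteq> {} \<and>
     finite (L \<inter> window \<kappa> t j) \<and> card (L \<inter> window \<kappa> t j) \<le> M}"

text \<open>Serves twice: as the approximation event at time t, with \<gamma> determined by \<psi>,
  and as an error set, with \<gamma> the window exponent of a later time.\<close>

definition hit :: "int \<Rightarrow> nat \<Rightarrow> int \<Rightarrow> 'n::finite \<Rightarrow> int \<Rightarrow> ('a::{field,finite} fls ^ ('m::finite + 'n)) set set" where
  "hit \<kappa> M t j \<gamma> = {L \<in> crowd \<kappa> M t j. L \<inter> cone_box \<kappa> t j \<gamma> \<noteq> {}}"

lemma crowd_measurable:
  fixes j :: "'n::finite"
  shows "(crowd \<kappa> M t j :: ('a::{field,finite} fls ^ ('m::finite + 'n)) set set) \<in> sets lattice_borel"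
    (is "?C \<in> _")
proof -
  have "?C = {L \<in> lattice_space. L \<inter> window \<kappa> t j \<noteq> {}} \<inter>
      {L \<in> lattice_space. finite (L \<inter> window \<kappa> t j) \<and> card (L \<inter> window \<kappa> t j) \<le> M}"
    by (auto simp: crowd_def)
  then show ?thesis
    unfolding window_def
    by (simp only: sets.Int sets_meets_lattice sets_few_lattice_points locally_constant_cone_box)
qed

lemma hit_measurable:
  fixes j :: "'n::finite"
  shows "(hit \<kappa> M t j \<gamma> :: ('a::{field,finite} fls ^ ('m::finite + 'n)) set set) \<in> sets lattice_borel"
    (is "?H \<in> _")
proof -
  have "?H = crowd \<kappa> M t j \<inter> {L \<in> lattice_space. L \<inter> cone_box \<kappa> t j \<gamma> \<noteq> {}}"
    by (auto simp: hit_def crowd_def)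
  then show ?thesis
    by (simp only: sets.Int crowd_measurable sets_meets_lattice locally_constant_cone_box)
qed

section \<open>Invariance of \<open>crowd\<close> and \<open>hit\<close>, and bounds on their
  measures\<close>

lemma image_Int_SL:
  assumes "\<And>v. h *v v \<in> B \<longleftrightarrow> v \<in> B'"
  shows "(*v) h ` L \<inter> B = (*v) h ` (L \<inter> B')"
  using assms by auto

lemma image_SL_card:
  assumes "h \<in> SL" "\<And>v. h *v v \<in> B \<longleftrightarrow> v \<in> B'"
  shows "(*v) h ` L \<inter> B \<noteq> {} \<longleftrightarrow> L \<inter> B' \<noteq> {}"
    "finite ((*v) h ` L \<inter> B) \<longleftrightarrow> finite (L \<inter> B')" "card ((*v) h ` L \<inter> B) = card (L \<inter> B')"
  using inj_on_subset[OF inj_SL[OF assms(1)] subset_UNIV, of "L \<inter> B'"]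
  by (auto simp: image_Int_SL[OF assms(2)] finite_image_iff card_image)

lemma lattice_space_image_iff:
  assumes "h \<in> SL"
  shows "(*v) h ` L \<in> lattice_space \<longleftrightarrow> L \<in> lattice_space"
  by (metis SL_inverse SL_image_cancel assms lattice_space_image)

lemma flow_crowd: "(*v) (flow t) ` L \<in> crowd \<kappa> M 0 j \<longleftrightarrow> L \<in> crowd \<kappa> M t j"
  by (simp add: crowd_def lattice_space_image_iff flow_in_SL
      image_SL_card[OF flow_in_SL flow_mem_window])

lemma shear_crowd:
  fixes L :: "('a::{field,finite} fls ^ ('m::finite + 'n::finite)) set"
  assumes "\<And>i. vanishes_below (int (CARD('m) + CARD('n)) * t - \<kappa>) (a $ i)"
  shows "(*v) (shear j a) ` L \<in> crowd \<kappa> M t j \<longleftrightarrow> L \<in> crowd \<kappa> M t j"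
  unfolding crowd_def window_def
  by (simp only: mem_Collect_eq lattice_space_image_iff[OF shear_in_SL]
      image_SL_card[OF shear_in_SL shear_mem_cone_box_iff[OF assms]])

lemma shear_hit:
  fixes L :: "('a::{field,finite} fls ^ ('m::finite + 'n::finite)) set"
  assumes "\<And>i. vanishes_below (int (CARD('m) + CARD('n)) * t - \<kappa>) (a $ i)" "\<And>i. vanishes_below \<gamma> (a $ i)"
  shows "(*v) (shear j a) ` L \<in> hit \<kappa> M t j \<gamma> \<longleftrightarrow> L \<in> hit \<kappa> M t j \<gamma>"
  by (simp only: hit_def mem_Collect_eq shear_crowd[OF assms(1)]
      image_SL_card[OF shear_in_SL shear_mem_cone_box_iff[OF assms(2)]])

text \<open>The flow makes the crowd at time t the preimage of the crowd at time 0.\<close>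

lemma measure_crowd:
  assumes "invariant_probability \<mu>"
  shows "measure \<mu> (crowd \<kappa> M t j) = measure \<mu> (crowd \<kappa> M 0 j)"
proof -
  have "{L \<in> space \<mu>. (*v) (flow t) ` L \<in> crowd \<kappa> M 0 j} = crowd \<kappa> M t j"
    by (auto simp: flow_crowd space_invariant_probability[OF assms]) (simp add: crowd_def)
  then show ?thesis
    using vimage_SL(2)[OF assms flow_in_SL, of "crowd \<kappa> M 0 j" t] assms
    by (simp add: crowd_measurable invariant_probability_def)
qed

text \<open>Average over the shears with \<open>a\<close> in
  \<open>digit_vecs (\<alpha> \<kappa> t) \<gamma>\<close>, all of which map S into S. For L in S a
  single vector in the window suffices: exactly the stated proportion of these shears brings its
  ratios into the ball of index \<gamma>.\<close>

lemma measure_hit_Int_ge: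
  fixes \<mu> :: "('a::{field,finite} fls ^ ('m::finite + 'n::finite)) set measure"
  defines "\<alpha> \<equiv> \<lambda>\<kappa> t. int (CARD('m) + CARD('n)) * t - \<kappa>"
  assumes \<mu>: "invariant_probability \<mu>" and S: "S \<in> sets \<mu>" "S \<subseteq> crowd \<kappa> M t j"
    and inv: "\<And>a L. \<forall>i. vanishes_below (\<alpha> \<kappa> t) (a $ i) \<Longrightarrow> L \<in> S \<Longrightarrow> (*v) (shear j a) ` L \<in> S"
    and \<gamma>: "\<alpha> \<kappa> t \<le> \<gamma>"
  shows "(1 / real CARD('a)) ^ (CARD('m) * nat (\<gamma> - \<alpha> \<kappa> t)) * measure \<mu> S
    \<le> measure \<mu> (hit \<kappa> M t j \<gamma> \<inter> S)"
proof (rule measure_ge_orbit_average[OF \<mu>, where h = "shear j" and I = "digit_vecs (\<alpha> \<kappa> t) \<gamma>"])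
  let ?I = "digit_vecs (\<alpha> \<kappa> t) \<gamma> :: ('a fls ^ 'm) set"
  show "hit \<kappa> M t j \<gamma> \<inter> S \<in> sets \<mu>"
    using S \<mu> by (auto simp: invariant_probability_def hit_measurable)
  show "?I \<noteq> {}" using digit_vecs_nonempty by blast
  fix L assume L: "L \<in> S"
  then obtain v where v: "v \<in> L" "v \<in> window \<kappa> t j" using S by (auto simp: crowd_def)
  let ?z = "\<lambda>i. v $ Inl i / v $ Inr j"
  have z: "vanishes_below (\<alpha> \<kappa> t) (?z i)" and low: "v \<in> low_box \<kappa> t j" for i
    using v by (auto simp: window_def cone_box_def \<alpha>_def)
  have "{a \<in> ?I. \<forall>i. vanishes_below \<gamma> (?z i + a $ i)} \<subseteq> {a \<in> ?I. (*v) (shear j a) ` L \<in> hit \<kappa> M t j \<gamma> \<inter> S}"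
  proof clarify
    fix a assume a: "a \<in> ?I" "\<forall>i. vanishes_below \<gamma> (?z i + a $ i)"
    have "\<forall>i. vanishes_below (\<alpha> \<kappa> t) (a $ i)"
      using a(1) by (auto simp: digit_vecs_def intro: digits_vanishes)
    then have "(*v) (shear j a) ` L \<in> S" using inv L by blast
    moreover have "shear j a *v v \<in> cone_box \<kappa> t j \<gamma>" using a low by (simp add: shear_mem_cone_box)
    ultimately show "(*v) (shear j a) ` L \<in> hit \<kappa> M t j \<gamma> \<inter> S"
      using S v by (auto simp: hit_def)
  qed
  then have "card {a \<in> ?I. \<forall>i. vanishes_below \<gamma> (?z i + a $ i)} \<le>
      card {a \<in> ?I. (*v) (shear j a) ` L \<in> hit \<kappa> M t j \<gamma> \<inter> S}"
    by (intro card_mono finite_subset[OF _ finite_digit_vecs]) auto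
  then show "(1 / real CARD('a)) ^ (CARD('m) * nat (\<gamma> - \<alpha> \<kappa> t)) * real (card ?I) \<le>
      real (card {a \<in> ?I. (*v) (shear j a) ` L \<in> hit \<kappa> M t j \<gamma> \<inter> S})"
    using card_digit_vecs_vanishes[where z = ?z, OF z \<gamma> order_refl] by simp
qed (use S finite_digit_vecs shear_in_SL in auto)

text \<open>A union bound over the at most M vectors in the window: a vector that a shear brings
  into the narrower cone comes from the window, and each window vector is brought there by exactly
  the proportion \<open>s^(-m (\<gamma> - \<alpha>))\<close> of the shears.\<close>

lemma measure_hit_le:
  fixes \<mu> :: "('a::{field,finite} fls ^ ('m::finite + 'n::finite)) set measure"
  defines "\<alpha> \<equiv> \<lambda>\<kappa> t. int (CARD('m) + CARD('n)) * t - \<kappa>"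
  assumes \<mu>: "invariant_probability \<mu>" and \<gamma>: "\<alpha> \<kappa> t \<le> \<gamma>"
  shows "measure \<mu> (hit \<kappa> M t j \<gamma>) \<le> real M * (1 / real CARD('a)) ^ (CARD('m) * nat (\<gamma> - \<alpha> \<kappa> t))"
proof (rule measure_le_orbit_average[OF \<mu>, where h = "shear j" and I = "digit_vecs (\<alpha> \<kappa> t) \<gamma>"])
  let ?I = "digit_vecs (\<alpha> \<kappa> t) \<gamma> :: ('a fls ^ 'm) set"
  let ?q = "(1 / real CARD('a)) ^ (CARD('m) * nat (\<gamma> - \<alpha> \<kappa> t))"
  show "hit \<kappa> M t j \<gamma> \<in> sets \<mu>"
    using \<mu> by (auto simp: invariant_probability_def hit_measurable)
  show "?I \<noteq> {}" using digit_vecs_nonempty by blast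
  fix L :: "('a fls ^ ('m + 'n)) set"
  let ?W = "L \<inter> window \<kappa> t j"
  let ?H = "{a \<in> ?I. (*v) (shear j a) ` L \<in> hit \<kappa> M t j \<gamma>}"
  let ?A = "\<lambda>v. {a \<in> ?I. \<forall>i. vanishes_below \<gamma> (v $ Inl i / v $ Inr j + a $ i)}"
  have small: "vanishes_below (\<alpha> \<kappa> t) (a $ i)" if "a \<in> ?I" for a i
    using that by (auto simp: digit_vecs_def intro: digits_vanishes)
  show "real (card ?H) \<le> real M * ?q * real (card ?I)"
  proof (cases "L \<in> crowd \<kappa> M t j")
    case False
    \<comment> \<open>These shears preserve the window, so none of them moves L into the
      crowd.\<close>
    have "?H = {}"
    proof (rule equals0I)
      fix a assume "a \<in> ?H"
      then have "a \<in> ?I" "(*v) (shear j a) ` L \<in> crowd \<kappa> M t j" by (auto simp: hit_def)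
      then show False using False shear_crowd[OF small[unfolded \<alpha>_def]] by (simp add: \<alpha>_def)
    qed
    then show ?thesis by (simp only: card.empty of_nat_0) simp
  next
    case True
    then have W: "finite ?W" "card ?W \<le> M" by (auto simp: crowd_def)
    have sub: "?H \<subseteq> (\<Union>v\<in>?W. ?A v)"
    proof clarify
      fix a assume a: "a \<in> ?I" "(*v) (shear j a) ` L \<in> hit \<kappa> M t j \<gamma>"
      then obtain v where v: "v \<in> L" "shear j a *v v \<in> cone_box \<kappa> t j \<gamma>" by (auto simp: hit_def)
      then have "shear j a *v v \<in> cone_box \<kappa> t j (\<alpha> \<kappa> t)" using cone_box_mono[OF \<gamma>] by blast
      then have "v \<in> cone_box \<kappa> t j (\<alpha> \<kappa> t)"
        by (simp only: shear_mem_cone_box_iff[OF small[OF a(1)]])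
      then have "v \<in> window \<kappa> t j" by (simp add: window_def \<alpha>_def)
      then show "a \<in> (\<Union>v\<in>?W. ?A v)" using v a(1) by (auto simp: shear_mem_cone_box)
    qed
    have "finite (?A v)" for v
      by (rule finite_subset[OF _ finite_digit_vecs]) auto
    then have "finite (\<Union>v\<in>?W. ?A v)" by (rule finite_UN_I[OF W(1)])
    then have "card ?H \<le> card (\<Union>v\<in>?W. ?A v)" by (rule card_mono[OF _ sub])
    also have "\<dots> \<le> (\<Sum>v\<in>?W. card (?A v))" by (rule card_UN_le[OF W(1)])
    finally have "real (card ?H) \<le> real (\<Sum>v\<in>?W. card (?A v))" by (simp only: of_nat_le_iff)
    also have "\<dots> = (\<Sum>v\<in>?W. real (card (?A v)))" by (simp only: of_nat_sum)
    also have "\<dots> = (\<Sum>v\<in>?W. ?q * real (card ?I))"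
    proof (rule sum.cong[OF refl])
      fix v assume "v \<in> ?W"
      then have "vanishes_below (\<alpha> \<kappa> t) (v $ Inl i / v $ Inr j)" for i
        by (auto simp: window_def cone_box_def \<alpha>_def)
      then show "real (card (?A v)) = ?q * real (card ?I)"
        by (rule card_digit_vecs_vanishes[OF _ \<gamma> order_refl])
    qed
    also have "\<dots> = real (card ?W) * ?q * real (card ?I)" by simp
    also have "\<dots> \<le> real M * ?q * real (card ?I)" using W(2) by (intro mult_right_mono) auto
    finally show ?thesis .
  qed
qed (use finite_digit_vecs shear_in_SL in auto)

section \<open>Divergence\<close>

lemma infinite_of_unbounded:
  fixes f :: "'b \<Rightarrow> real"
  assumes "\<And>B. \<exists>v\<in>L. B < f v \<and> P v"
  shows "infinite {v \<in> L. f v > R \<and> P v}"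
proof
  assume fin: "finite {v \<in> L. f v > R \<and> P v}"
  \<comment> \<open>Inserting R makes the set nonempty and ensures that a vector beyond B satisfies
    \<open>f v > R\<close>.\<close>
  define B where "B = Max (insert R (f ` {v \<in> L. f v > R \<and> P v}))"
  obtain v where v: "v \<in> L" "B < f v" "P v" using assms by blast
  have "R \<le> B" unfolding B_def using fin by (intro Max_ge) auto
  then have "f v \<le> B" unfolding B_def using fin v by (intro Max_ge) (auto simp: B_def[symmetric])
  then show False using v by simp
qed

text \<open>Ratios at most \<open>s^(-((m+n)t - \<kappa> + b))\<close> and a lower norm at most
  \<open>s^(mt + \<kappa>)\<close> give an upper norm at most
  \<open>s^(-(nt - 2\<kappa> + b))\<close>. The hypothesis on b compares the m-th power of this with
  \<psi> at the largest lower norm that the box allows, the worst case for non-increasing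
  \<psi>.\<close>

lemma cone_box_norms:
  fixes \<psi> :: "real \<Rightarrow> real" and v :: "'a::{field,finite} fls ^ ('m::finite + 'n::finite)"
  defines "s \<equiv> real CARD('a)"
  assumes anti: "antimono_on {0<..} \<psi>"
    and v: "v \<in> cone_box \<kappa> t j (int (CARD('m) + CARD('n)) * t - \<kappa> + int b)"
    and b: "((1 / s) ^ CARD('m)) ^ b \<le>
      \<psi> ((s powi (int CARD('m) * t + \<kappa>)) ^ CARD('n)) * s powi (int CARD('m) * (int CARD('n) * t - 2 * \<kappa>))"
  shows "s powi (int CARD('m) * t - \<kappa> - 1) < vnorm (lower_part v)"
    and "vnorm (upper_part v) ^ CARD('m) \<le> \<psi> (vnorm (lower_part v) ^ CARD('n))"
proof -
  let ?m = "int CARD('m)" and ?n = "int CARD('n)"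
  have s: "1 < s" unfolding s_def by (rule one_less_CARD)
  have low: "v \<in> low_box \<kappa> t j" and z: "vanishes_below (int (CARD('m) + CARD('n)) * t - \<kappa> + int b) (v $ Inl i / v $ Inr j)" for i
    using v by (auto simp: cone_box_def)
  have "vnorm (lower_part v) \<le> s powi (- (- (?m * t) - \<kappa>))"
    unfolding s_def vnorm_le_iff using low by (auto simp: low_box_def lower_part_def)
  then have low_le: "vnorm (lower_part v) \<le> s powi (?m * t + \<kappa>)" by (simp add: add.commute)
  have e: "?m * t - \<kappa> - 1 = - (\<kappa> + 1 - ?m * t)" by simp
  \<comment> \<open>Nonzero absolute values are powers of s, so the lower bound
    \<open>s^(mt - \<kappa>)\<close> appears as a strict one with exponent smaller by 1.\<close>
  have "\<not> abs_fls (v $ Inr j) \<le> s powi (?m * t - \<kappa> - 1)"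
    unfolding e s_def abs_fls_le_iff using low by (auto simp: low_box_def)
  moreover have "abs_fls (v $ Inr j) \<le> vnorm (lower_part v)"
    using abs_fls_le_vnorm[of "lower_part v" j] by (simp add: lower_part_def)
  ultimately show low_gt: "s powi (?m * t - \<kappa> - 1) < vnorm (lower_part v)" by linarith
  have "0 < s powi (?m * t - \<kappa> - 1)" using s by simp
  then have low_pos: "0 < vnorm (lower_part v)" using low_gt by linarith
  have up_le: "vnorm (upper_part v) \<le> s powi (- (?n * t - 2 * \<kappa> + int b))"
    unfolding s_def vnorm_le_iff
  proof
    fix i
    have vb: "vanishes_below (int (CARD('m) + CARD('n)) * t - \<kappa> + int b + (- (?m * t) - \<kappa>)) (v $ Inl i / v $ Inr j * v $ Inr j)"
      using z low by (intro vanishes_below_mult) (auto simp: low_box_def)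
    have e1: "v $ Inl i / v $ Inr j * v $ Inr j = v $ Inl i" using low_box_nonzero[OF low] by simp
    have e2: "int (CARD('m) + CARD('n)) * t - \<kappa> + int b + (- (?m * t) - \<kappa>) = ?n * t - 2 * \<kappa> + int b"
      by (simp add: algebra_simps)
    show "vanishes_below (?n * t - 2 * \<kappa> + int b) (upper_part v $ i)"
      using vb unfolding e1 e2 by (simp add: upper_part_def)
  qed
  have "vnorm (upper_part v) ^ CARD('m) \<le> (s powi (- (?n * t - 2 * \<kappa> + int b))) ^ CARD('m)"
    by (intro power_mono up_le vnorm_nonneg)
  also have "\<dots> = ((1 / s) ^ CARD('m)) ^ b * s powi (- (?m * (?n * t - 2 * \<kappa>)))"
  proof -
    have "(s powi (- (?n * t - 2 * \<kappa> + int b))) ^ CARD('m) = s powi (?m * (- (?n * t - 2 * \<kappa> + int b)))"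
      by (simp only: power_int_mult power_int_of_nat mult.commute[of ?m])
    also have "?m * (- (?n * t - 2 * \<kappa> + int b)) = - (int (CARD('m) * b)) + - (?m * (?n * t - 2 * \<kappa>))"
      by (simp add: algebra_simps)
    also have "s powi \<dots> = s powi (- (int (CARD('m) * b))) * s powi (- (?m * (?n * t - 2 * \<kappa>)))"
      using s by (subst power_int_add) auto
    also have "s powi (- (int (CARD('m) * b))) = ((1 / s) ^ CARD('m)) ^ b"
      by (simp only: power_int_minus power_int_of_nat power_one_over power_mult inverse_eq_divide)
    finally show ?thesis .
  qed
  also have "\<dots> \<le> (\<psi> ((s powi (?m * t + \<kappa>)) ^ CARD('n)) * s powi (?m * (?n * t - 2 * \<kappa>))) * s powi (- (?m * (?n * t - 2 * \<kappa>)))"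
    using s by (intro mult_right_mono b) auto
  also have "\<dots> = \<psi> ((s powi (?m * t + \<kappa>)) ^ CARD('n))"
    using s by (simp add: power_int_minus)
  also have "\<dots> \<le> \<psi> (vnorm (lower_part v) ^ CARD('n))"
    using s low_le low_pos by (intro monotone_onD[OF anti]) (auto intro: power_mono)
  finally show "vnorm (upper_part v) ^ CARD('m) \<le> \<psi> (vnorm (lower_part v) ^ CARD('n))" .
qed

text \<open>The cones are nested. Thus an earlier event united with its error set is again a
  \<open>hit\<close>, with the coarser of the two bounds, and \<open>shear_hit\<close> applies to
  it.\<close>

lemma hit_Un: "hit \<kappa> M t j \<gamma> \<union> hit \<kappa> M t j \<delta> = hit \<kappa> M t j (min \<gamma> \<delta>)"
  using cone_box_mono[of "min \<gamma> \<delta>" \<gamma> \<kappa> t j] cone_box_mono[of "min \<gamma> \<delta>" \<delta> \<kappa> t j]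
  by (cases "\<gamma> \<le> \<delta>") (auto simp: hit_def min_def)

text \<open>Exhaustion in two steps, each costing \<open>\<epsilon> / 2\<close>: every lattice meets
  the window for large \<kappa>, and it has finitely many vectors there.\<close>

lemma ex_crowd_large:
  fixes \<mu> :: "('a::{field,finite} fls ^ ('m::finite + 'n::finite)) set measure" and j :: 'n
  assumes \<mu>: "invariant_probability \<mu>" and "0 < \<epsilon>"
  shows "\<exists>\<kappa>::nat. \<exists>M. 1 - \<epsilon> \<le> measure \<mu> (crowd (int \<kappa>) M 0 j)"
proof -
  interpret prob_space \<mu> using \<mu> by (simp add: invariant_probability_def)
  have sp: "space \<mu> = lattice_space" by (rule space_invariant_probability[OF \<mu>])
  have sets: "sets \<mu> = sets lattice_borel" using \<mu> by (simp add: invariant_probability_def)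
  let ?A = "\<lambda>k::nat. {L \<in> lattice_space. L \<inter> window (int k) 0 j \<noteq> {}} :: ('a fls ^ ('m + 'n)) set set"
  have "(\<Union>k. ?A k) = space \<mu>" using lattice_meets_window[of _ j] by (auto simp: sp)
  moreover have "incseq ?A"
    unfolding incseq_def using window_mono[of "int k" "int k'" 0 j for k k'] by fastforce
  moreover have "range ?A \<subseteq> events"
    unfolding sets window_def by (auto intro: sets_meets_lattice locally_constant_cone_box)
  ultimately obtain \<kappa> where \<kappa>: "1 - \<epsilon> / 2 \<le> prob (?A \<kappa>)"
    using ex_prob_ge_of_incseq[of ?A "\<epsilon> / 2"] \<open>0 < \<epsilon>\<close> by (auto simp: prob_space)
  let ?C = "\<lambda>M. crowd (int \<kappa>) M 0 j :: ('a fls ^ ('m + 'n)) set set"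
  have "finite (L \<inter> window (int \<kappa>) 0 j)" if "L \<in> lattice_space" for L :: "('a fls ^ ('m + 'n)) set"
    unfolding window_def by (rule finite_lattice_cone_box[OF that])
  then have "(\<Union>M. ?C M) = ?A \<kappa>"
    unfolding crowd_def by (blast intro: order_refl)
  moreover have "incseq ?C" unfolding incseq_def crowd_def by auto
  moreover have "range ?C \<subseteq> events" unfolding sets using crowd_measurable by auto
  ultimately obtain M where "prob (?A \<kappa>) - \<epsilon> / 2 \<le> prob (?C M)"
    using ex_prob_ge_of_incseq[of ?C "\<epsilon> / 2"] \<open>0 < \<epsilon>\<close> by auto
  then have "1 - \<epsilon> \<le> prob (?C M)" using \<kappa> by linarith
  then show ?thesis by blast
qed

text \<open>X is the limsup of the approximation events. This inner set avoids the question whether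
  the approximable lattices form a measurable set.\<close>

lemma ex_approximable_large:
  fixes \<psi> :: "real \<Rightarrow> real"
    and \<mu> :: "(('a::{field,finite} fls) ^ ('m::finite + 'n::finite)) set measure"
  assumes nn: "\<And>x. 0 < x \<Longrightarrow> 0 \<le> \<psi> x" and anti: "antimono_on {0<..} \<psi>"
    and div: "\<not> summable (\<lambda>x::nat. \<psi> (real (Suc x)))"
    and \<mu>: "invariant_probability \<mu>" and eps: "0 < \<epsilon>"
  shows "\<exists>X\<in>sets \<mu>. X \<subseteq> {L. approximable \<psi> L} \<and> 1 - 3 * \<epsilon> \<le> measure \<mu> X"
proof -
  interpret prob_space \<mu> using \<mu> by (simp add: invariant_probability_def)
  have sets: "sets \<mu> = sets lattice_borel" using \<mu> by (simp add: invariant_probability_def)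
  \<comment> \<open>Any lower coordinate can serve as the common denominator of the ratios.\<close>
  define j :: 'n where "j = undefined"
  define s where "s = real CARD('a)"
  define m where "m = CARD('m)"
  define n where "n = CARD('n)"
  have s: "1 < s" unfolding s_def by (rule one_less_CARD)
  have mn: "0 < m" "0 < n" by (simp_all add: m_def n_def)
  obtain \<kappa> M where crowd: "1 - \<epsilon> \<le> prob (crowd (int \<kappa>) M 0 j)"
    using ex_crowd_large[OF \<mu> eps, of j] by blast
  \<comment> \<open>One unit of flow time raises the window exponent by m + n and so contributes the
    factor \<open>r\<close> in \<open>measure_hit_le\<close>.\<close>
  define r where "r = (1 / s) ^ (m * (m + n))"
  have r: "0 < r" "r < 1" using s mn by (auto simp: r_def power_less_one_iff)
  \<comment> \<open>The spacing d of the times: \<open>r ^ d \<le> 1 / 2\<close> bounds the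
    geometric sum by \<open>2 * r ^ d\<close>, and the other bound makes M times this at most
    \<epsilon>. Strictness at 1/2 excludes d = 0.\<close>
  have "0 < min (1 / 2) (\<epsilon> / (2 * (real M + 1)))" using eps by simp
  then obtain d where d: "r ^ d < min (1 / 2) (\<epsilon> / (2 * (real M + 1)))"
    using real_arch_pow_inv[OF _ r(2)] by blast
  have "d \<noteq> 0" using d by (intro notI) simp
  have rd: "0 \<le> r ^ d" "r ^ d \<le> 1 / 2" using d r by auto
  have Mrd: "real M * (2 * r ^ d) \<le> \<epsilon>"
  proof -
    have "r ^ d * (2 * (real M + 1)) < \<epsilon>" using d by (simp add: pos_less_divide_eq)
    moreover have "0 \<le> 2 * r ^ d" using rd by simp
    ultimately show ?thesis by (simp add: algebra_simps)
  qed
  define t where "t \<tau> = int (d * \<tau>)" for \<tau>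
  define \<alpha> where "\<alpha> \<tau> = int (m + n) * t \<tau> - int \<kappa>" for \<tau>
  define p where "p = (1 / s) ^ m"
  have p: "0 < p" "p < 1" using s mn by (auto simp: p_def power_less_one_iff)
  \<comment> \<open>The right side of the condition on b in \<open>cone_box_norms\<close>;
    \<open>b \<tau>\<close> will be chosen such that \<open>p ^ b \<tau>\<close> is below it by at
    most a factor p, unless it equals 1.\<close>
  define y where "y \<tau> = \<psi> ((s powi (int m * t \<tau> + int \<kappa>)) ^ n) * s powi (int m * (int n * t \<tau> - 2 * int \<kappa>))" for \<tau>
  have y_pos: "0 < y \<tau>" for \<tau>
    unfolding y_def using s by (intro mult_pos_pos pos_of_not_summable[OF nn anti div]) auto
  obtain b where b: "\<And>\<tau>. p ^ b \<tau> \<le> y \<tau>" "\<And>\<tau>. min 1 (p * y \<tau>) \<le> p ^ b \<tau>"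
    using ex_power_close_below[OF p y_pos] by metis
  \<comment> \<open>Up to a constant these are the terms of the condensed series with
    \<open>K = s^(n \<kappa>)\<close> and \<open>Q = s^(n m d)\<close>.\<close>
  have y_eq: "y \<tau> = s powi (- (int m * (2 * int \<kappa>))) *
      (real (CARD('a) ^ (n * m * d)) ^ \<tau> * \<psi> (real (CARD('a) ^ (n * \<kappa>)) * real (CARD('a) ^ (n * m * d)) ^ \<tau>))" for \<tau>
  proof -
    have "(s powi (int m * t \<tau> + int \<kappa>)) ^ n = (s ^ (m * (d * \<tau>) + \<kappa>)) ^ n"
      by (simp only: t_def of_nat_mult[symmetric] of_nat_add[symmetric] power_int_of_nat)
    also have "\<dots> = s ^ (n * \<kappa>) * (s ^ (n * m * d)) ^ \<tau>"
      by (simp add: power_add[symmetric] power_mult[symmetric] algebra_simps)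
    finally have 1: "(s powi (int m * t \<tau> + int \<kappa>)) ^ n = s ^ (n * \<kappa>) * (s ^ (n * m * d)) ^ \<tau>" .
    have "int m * (int n * t \<tau> - 2 * int \<kappa>) = - (int m * (2 * int \<kappa>)) + int (n * m * d * \<tau>)"
      by (simp add: t_def algebra_simps)
    then have "s powi (int m * (int n * t \<tau> - 2 * int \<kappa>)) =
        s powi (- (int m * (2 * int \<kappa>))) * s powi int (n * m * d * \<tau>)"
      using s by (simp only:) (subst power_int_add, auto)
    also have "s powi int (n * m * d * \<tau>) = (s ^ (n * m * d)) ^ \<tau>"
      by (simp only: power_int_of_nat power_mult)
    finally show ?thesis unfolding y_def 1 by (simp add: s_def mult_ac)
  qed
  have "\<not> summable (\<lambda>\<tau>. p ^ b \<tau>)"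
  proof
    assume "summable (\<lambda>\<tau>. p ^ b \<tau>)"
    then have "summable (\<lambda>\<tau>. min 1 (p * y \<tau>))"
    proof (rule summable_comparison_test'[where N = 0])
      fix \<tau>
      show "norm (min 1 (p * y \<tau>)) \<le> p ^ b \<tau>"
        using b(2)[of \<tau>] mult_pos_pos[OF p(1) y_pos[of \<tau>]] by auto
    qed
    moreover have "\<not> summable y"
    proof -
      have "2 ^ 1 \<le> CARD('a) ^ (n * m * d)"
        using s mn \<open>d \<noteq> 0\<close> by (intro order_trans[OF power_mono power_increasing]) (auto simp: s_def)
      moreover have "1 \<le> CARD('a) ^ (n * \<kappa>)" by simp
      moreover have "s powi (- (int m * (2 * int \<kappa>))) \<noteq> 0" using s by simp
      ultimately show ?thesis
        unfolding y_eq summable_cmult_iff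
        using not_summable_condensed[OF nn anti div, of "CARD('a) ^ (n * \<kappa>)" "CARD('a) ^ (n * m * d)"] by simp
    qed
    ultimately show False using not_summable_min_one[OF p(1)] by blast
  qed
  define D where "D \<tau> = (crowd (int \<kappa>) M (t \<tau>) j :: ('a fls ^ ('m + 'n)) set set)" for \<tau>
  define E where "E \<tau> = (hit (int \<kappa>) M (t \<tau>) j (\<alpha> \<tau> + int (b \<tau>)) :: ('a fls ^ ('m + 'n)) set set)" for \<tau>
  \<comment> \<open>The bound on the ratios at time i is replaced by the window exponent of the
    later time \<tau>, a precision that the shears of time \<tau> cannot disturb.\<close>
  define Y where "Y i \<tau> = (if i < \<tau> then hit (int \<kappa>) M (t i) j (\<alpha> \<tau>) else {} :: ('a fls ^ ('m + 'n)) set set)" for i \<tau>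
  have meas: "D \<tau> \<in> events" "E \<tau> \<in> events" "Y i \<tau> \<in> events" for \<tau> i
    by (auto simp: D_def E_def Y_def sets crowd_measurable hit_measurable)
  have \<alpha>_diff: "\<alpha> \<tau> - \<alpha> i = int ((m + n) * d * (\<tau> - i))" if "i \<le> \<tau>" for i \<tau>
  proof -
    have "\<alpha> \<tau> - \<alpha> i = int (m + n) * int d * (int \<tau> - int i)"
      by (simp add: \<alpha>_def t_def algebra_simps)
    also have "int \<tau> - int i = int (\<tau> - i)" using that by simp
    finally show ?thesis by (simp only: of_nat_mult)
  qed
  have "1 - 3 * \<epsilon> \<le> prob (\<Inter>T. \<Union>i\<in>{T..}. E i)"
  proof (rule prob_limsup_ge[where D = D and Y = Y and p = "\<lambda>\<tau>. p ^ b \<tau>"])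
    show "1 - \<epsilon> \<le> prob (D \<tau>)" for \<tau>
      using crowd measure_crowd[OF \<mu>, of "int \<kappa>" M "t \<tau>" j] by (simp add: D_def)
    show "(\<Sum>i<\<tau>. prob (Y i \<tau>)) \<le> \<epsilon>" for \<tau>
    proof -
      have "prob (Y i \<tau>) \<le> real M * (r ^ d) ^ (\<tau> - i)" if "i < \<tau>" for i
      proof -
        have "\<alpha> i \<le> \<alpha> \<tau>" using \<alpha>_diff[of i \<tau>] that by (smt (verit) of_nat_0_le_iff less_imp_le)
        then have "prob (Y i \<tau>) \<le> real M * (1 / s) ^ (m * nat (\<alpha> \<tau> - \<alpha> i))"
          using measure_hit_le[OF \<mu>, of "t i" "int \<kappa>" "\<alpha> \<tau>" M j] that
          by (simp add: Y_def \<alpha>_def m_def n_def s_def)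
        also have "\<dots> = real M * (r ^ d) ^ (\<tau> - i)"
          using that by (simp add: \<alpha>_diff r_def power_mult[symmetric] mult_ac del: of_nat_mult)
        finally show ?thesis .
      qed
      then have "(\<Sum>i<\<tau>. prob (Y i \<tau>)) \<le> (\<Sum>i<\<tau>. real M * (r ^ d) ^ (\<tau> - i))"
        by (intro sum_mono) auto
      also have "\<dots> = real M * (\<Sum>i<\<tau>. (r ^ d) ^ (\<tau> - i))" by (simp add: sum_distrib_left)
      also have "\<dots> \<le> real M * (2 * r ^ d)" by (intro mult_left_mono sum_geometric_tail_le rd) simp
      also have "\<dots> \<le> \<epsilon>" by (rule Mrd)
      finally show ?thesis .
    qed
    fix T \<tau> :: nat assume "T \<le> \<tau>"
    let ?S = "D \<tau> - (\<Union>i\<in>{T..<\<tau>}. E i \<union> Y i \<tau>)"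
    have "(1 / real CARD('a)) ^ (CARD('m) * nat (\<alpha> \<tau> + int (b \<tau>) - \<alpha> \<tau>)) * prob ?S \<le>
        prob (hit (int \<kappa>) M (t \<tau>) j (\<alpha> \<tau> + int (b \<tau>)) \<inter> ?S)"
      unfolding \<alpha>_def m_def n_def
    proof (rule measure_hit_Int_ge[OF \<mu>], fold m_def n_def, fold \<alpha>_def)
      show "?S \<in> events" using meas by auto
      show "?S \<subseteq> crowd (int \<kappa>) M (t \<tau>) j" by (auto simp: D_def)
      fix a :: "'a fls ^ 'm" and L
      assume a: "\<forall>i. vanishes_below (\<alpha> \<tau>) (a $ i)" and L: "L \<in> ?S"
      have "(*v) (shear j a) ` L \<in> E i \<union> Y i \<tau> \<longleftrightarrow> L \<in> E i \<union> Y i \<tau>" if "i < \<tau>" for i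
      proof -
        have "\<alpha> i \<le> \<alpha> \<tau>" using \<alpha>_diff[of i \<tau>] that by (smt (verit) of_nat_0_le_iff less_imp_le)
        \<comment> \<open>The union of \<open>E i\<close> and \<open>Y i \<tau>\<close> is a
          \<open>hit\<close> whose bound, this minimum, is at most
          \<open>\<alpha> \<tau>\<close>.\<close>
        then have "vanishes_below (\<alpha> i) (a $ k)" "vanishes_below (min (\<alpha> i + int (b i)) (\<alpha> \<tau>)) (a $ k)" for k
          using a by (auto intro: vanishes_below_mono)
        note shear_hit[OF this[unfolded \<alpha>_def m_def n_def]]
        then show ?thesis using that by (simp add: E_def Y_def hit_Un \<alpha>_def m_def n_def)
      qed
      moreover have "(*v) (shear j a) ` L \<in> D \<tau> \<longleftrightarrow> L \<in> D \<tau>"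
        unfolding D_def using a by (intro shear_crowd) (simp add: \<alpha>_def m_def n_def)
      ultimately show "(*v) (shear j a) ` L \<in> ?S" using L by simp
    qed simp
    then show "p ^ b \<tau> * prob ?S \<le> prob (E \<tau> \<inter> ?S)"
      by (simp add: E_def p_def s_def m_def power_mult)
  qed (use meas p eps \<open>\<not> summable (\<lambda>\<tau>. p ^ b \<tau>)\<close> in auto)
  moreover have "(\<Inter>T. \<Union>i\<in>{T..}. E i) \<in> events" using meas by auto
  moreover have "(\<Inter>T. \<Union>i\<in>{T..}. E i) \<subseteq> {L. approximable \<psi> L}"
  proof
    fix L assume L: "L \<in> (\<Inter>T. \<Union>i\<in>{T..}. E i)"
    have "\<exists>v\<in>L. B < vnorm (lower_part v) \<and> vnorm (upper_part v) ^ CARD('m) \<le> \<psi> (vnorm (lower_part v) ^ CARD('n))" for B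
    proof -
      obtain N :: nat where N: "B < s ^ N" using real_arch_pow[OF s] by blast
      \<comment> \<open>Since \<open>\<tau> \<le> m * d * \<tau>\<close>, this choice lifts the
        exponent \<open>m d \<tau> - \<kappa> - 1\<close> to at least N.\<close>
      obtain \<tau> where \<tau>: "N + \<kappa> + 1 \<le> \<tau>" "L \<in> E \<tau>" using L by blast
      then obtain v where v: "v \<in> L" "v \<in> cone_box (int \<kappa>) (t \<tau>) j (\<alpha> \<tau> + int (b \<tau>))"
        by (auto simp: E_def hit_def)
      note norms = cone_box_norms[OF anti v(2)[unfolded \<alpha>_def m_def n_def]
          b(1)[of \<tau>, unfolded p_def y_def s_def m_def n_def]]
      have "\<tau> \<le> m * d * \<tau>" using mn \<open>d \<noteq> 0\<close> by simp
      then have "int N \<le> int (m * d * \<tau>) - int \<kappa> - 1" using \<tau> by linarith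
      then have "s powi int N \<le> s powi (int m * t \<tau> - int \<kappa> - 1)"
        using s by (intro power_int_increasing) (auto simp: t_def mult_ac)
      then have "B < vnorm (lower_part v)"
        using N norms(1) by (simp add: s_def m_def)
      with norms(2) v(1) show ?thesis by blast
    qed
    then have "approximable \<psi> L"
      unfolding approximable_def by (intro allI infinite_of_unbounded)
    then show "L \<in> {L. approximable \<psi> L}" by simp
  qed
  ultimately show ?thesis by blast
qed

theorem theorem5p2:
  fixes \<psi> :: "real \<Rightarrow> real"
    and \<mu> :: "(('a::{field,finite} fls) ^ ('m::finite + 'n::finite)) set measure"
  assumes "\<And>x. x > 0 \<Longrightarrow> \<psi> x \<ge> 0"
    and "antimono_on {0<..} \<psi>"
    and "continuous_on {0<..} \<psi>"
    and "\<not> summable (\<lambda>x::nat. \<psi> (real (Suc x)))"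
    and "invariant_probability \<mu>"
  shows "AE L in \<mu>. approximable \<psi> L"
proof -
  interpret prob_space \<mu> using assms(5) by (simp add: invariant_probability_def)
  \<comment> \<open>With \<epsilon> = 1/(k+1) tending to 0, the countable union of the inner sets
    has probability 1.\<close>
  have "\<exists>X\<in>events. X \<subseteq> {L. approximable \<psi> L} \<and> 1 - 3 * (1 / real (Suc k)) \<le> prob X" for k
    by (rule ex_approximable_large[OF assms(1,2,4,5)]) simp_all
  then obtain X where X: "\<And>k. X k \<in> events" "\<And>k. X k \<subseteq> {L. approximable \<psi> L}"
    "\<And>k. 1 - 3 * (1 / real (Suc k)) \<le> prob (X k)"
    by metis
  have "1 \<le> prob (\<Union>k. X k)"
  proof (rule LIMSEQ_le_const2)
    show "(\<lambda>k. 1 - 3 * (1 / real (Suc k))) \<longlonglongrightarrow> 1"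
      using tendsto_diff[OF tendsto_const tendsto_mult_right_zero[OF LIMSEQ_inverse_real_of_nat, of 3], of 1]
      by (simp add: inverse_eq_divide)
    have "1 - 3 * (1 / real (Suc k)) \<le> prob (\<Union>k. X k)" for k
      using X by (intro order_trans[OF X(3) finite_measure_mono]) auto
    then show "\<exists>N. \<forall>k\<ge>N. 1 - 3 * (1 / real (Suc k)) \<le> prob (\<Union>k. X k)" by blast
  qed
  then have "AE L in \<mu>. L \<in> (\<Union>k. X k)"
    using X(1) prob_le_1[of "\<Union>k. X k"] by (intro AE_prob_1) linarith
  then show ?thesis by eventually_elim (use X(2) in blast)
qed

end
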